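(* Assume that the functions $g$, $h$ and $(x,y,z)\mapsto H(t,x,y,z,v,k,p,P)$ are convex, and that for any $v\in\mathcal{U}$, $y_T^v=\xi$, where $\xi$ is an $m$-dimensional $\mathcal{F}_T$-measurable random variable such that $\mathbb{E}|\xi|^2<\infty$. Let $u\in\mathcal{U}$, with trajectory $(x^u,y^u,z^u)$ and adjoint processes $(k^u,p^u,P^u)$, satisfy: for every $v_t\in U$, $$H(t,x_t^{u},y_t^{u},z_t^{u},u_t,k_t^{u},p_t^{u},P_t^{u})\le H(t,x_t^{u},y_t^{u},z_t^{u},v_t,k_t^{u},p_t^{u},P_t^{u}),\quad \text{for a.e. } t\in[0,T],\ \mathcal{P}\text{-a.s.}$$ Then $u$ is an optimal strict control: $J(u)=\inf_{v\in\mathcal{U}}J(v)$.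
   Context: Setting. $(\Omega,\mathcal{F},(\mathcal{F}_t)_{t\ge0},\mathcal{P})$ is a filtered probability space satisfying the usual conditions, carrying a $d$-dimensional Brownian motion $W$; $(\mathcal{F}_t)$ is the $\mathcal{P}$-augmentation of the natural filtration of $W$. $T>0$, and $U$ is a non-empty compact subset of $\mathbb{R}^k$ (not assumed convex). $\mathcal{M}_{m\times d}(\mathbb{R})$ denotes the real $m\times d$ matrices. Data: $b:[0,T]\times\mathbb{R}^n\times U\to\mathbb{R}^n$, $\sigma:[0,T]\times\mathbb{R}^n\times U\to\mathcal{M}_{n\times d}(\mathbb{R})$, $f:[0,T]\times\mathbb{R}^n\times\mathbb{R}^m\times\mathcal{M}_{m\times d}(\mathbb{R})\times U\to\mathbb{R}^m$, $g:\mathbb{R}^n\to\mathbb{R}$, $h:\mathbb{R}^m\to\mathbb{R}$, $l:[0,T]\times\mathbb{R}^n\times\mathbb{R}^m\times\mathcal{M}_{m\times d}(\mathbb{R})\times U\to\mathbb{R}$; $x$ is an $n$-dimensional $\mathcal{F}_0$-measurable random variable with $\mathbb{E}|x|^2<\infty$. Standing assumptions: $b,\sigma,f,g,h,l$ are continuously differentiable with respect to $(x,y,z)$, are bounded by $C(1+|x|+|y|+|z|+|v|)$ for a constant $C$, and their derivatives with respect to $(x,y,z)$ are continuous in $(x,y,z,v)$ and uniformly bounded; moreover $b,\sigma,f,l$ are bounded. Strict controls. $\mathcal{U}$ is the set of $\mathcal{F}_t$-adapted processes $v=(v_t)$ with values in $U$ such that $\mathbb{E}[\sup_{t\in[0,T]}|v_t|^2]<\infty$.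 For $v\in\mathcal{U}$, $(x^v,y^v,z^v)$ is the unique strong solution of $$dx_t^v=b(t,x_t^v,v_t)\,dt+\sigma(t,x_t^v,v_t)\,dW_t,\ x_0^v=x;\qquad dy_t^v=-f(t,x_t^v,y_t^v,z_t^v,v_t)\,dt+z_t^v\,dW_t,\ y_T^v=\xi,$$ and $J(v)=\mathbb{E}\big[g(x_T^v)+h(y_0^v)+\int_0^T l(t,x_t^v,y_t^v,z_t^v,v_t)\,dt\big]$. Hamiltonian. For $(t,x,y,z,v,k,p,P)\in[0,T]\times\mathbb{R}^n\times\mathbb{R}^m\times\mathcal{M}_{m\times d}(\mathbb{R})\times U\times\mathbb{R}^m\times\mathbb{R}^n\times\mathcal{M}_{n\times d}(\mathbb{R})$, $$H(t,x,y,z,v,k,p,P)=l(t,x,y,z,v)+p\,b(t,x,v)+P\,\sigma(t,x,v)+k\,f(t,x,y,z,v),$$ where products of vectors (resp. matrices) of equal size are the standard inner products; subscripts $x,y,z$ denote partial derivatives. Convexity of $(x,y,z)\mapsto H(t,x,y,z,v,k,p,P)$ is for fixed values of the other arguments. Adjoint processes. $(k^u,p^u,P^u)$ is the unique adapted solution of $$dk_t^u=H_y\,dt+H_z\,dW_t,\ k_0^u=h_y(y_0^u);\qquad dp_t^u=-H_x\,dt+P_t^u\,dW_t,\ p_T^u=g_x(x_T^u),$$ with $H_x,H_y,H_z$ evaluated at $(t,x_t^u,y_t^u,z_t^u,u_t,k_t^u,p_t^u,P_t^u)$. *)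

theory Defs
  imports "HOL-Probability.Probability"
begin

definition usual_conditions :: "'w measure \<Rightarrow> (real \<Rightarrow> 'w measure) \<Rightarrow> bool" where
  "usual_conditions M F \<longleftrightarrow>
     filtration (space M) F \<and> (\<forall>t. subalgebra M (F t)) \<and>
     complete_measure M \<and> null_sets M \<subseteq> sets (F 0) \<and>
     (\<forall>t\<ge>0. sets (F t) = (\<Inter>s\<in>{t<..}. sets (F s)))"

text \<open>Time is indexed by all reals, but only times \<open>t \<ge> 0\<close> carry information on \<open>W\<close>;
  for \<open>t < 0\<close> the augmented filtration is generated by the null sets alone.\<close>

definition augmented_natural_filtration ::
  "'w measure \<Rightarrow> (real \<Rightarrow> 'w \<Rightarrow> real^'d) \<Rightarrow> real \<Rightarrow> 'w measure" where
  "augmented_natural_filtration M W t =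
     sigma (space M)
       ({W s -` A \<inter> space M | s A. 0 \<le> s \<and> s \<le> t \<and> A \<in> sets borel} \<union> null_sets M)"

text \<open>The last three conjuncts say that \<open>W t - W s\<close> is independent of \<open>F s\<close> and centred
  Gaussian with covariance matrix \<open>t - s\<close> times the identity.\<close>

definition brownian_motion ::
  "'w measure \<Rightarrow> (real \<Rightarrow> 'w measure) \<Rightarrow> (real \<Rightarrow> 'w \<Rightarrow> real^'d) \<Rightarrow> bool" where
  "brownian_motion M F W \<longleftrightarrow>
     (\<forall>t\<ge>0. W t \<in> borel_measurable (F t)) \<and>
     (AE \<omega> in M. W 0 \<omega> = 0) \<and>
     (AE \<omega> in M. continuous_on {0..} (\<lambda>t. W t \<omega>)) \<and>
     (\<forall>s t. 0 \<le> s \<and> s < t \<longrightarrow>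
        prob_space.indep_set M (sets (F s))
          (sets (vimage_algebra (space M) (\<lambda>\<omega>. W t \<omega> - W s \<omega>) borel)) \<and>
        prob_space.indep_vars M (\<lambda>_. borel) (\<lambda>i \<omega>. (W t \<omega> - W s \<omega>) $ i) UNIV \<and>
        (\<forall>i. distributed M lborel (\<lambda>\<omega>. (W t \<omega> - W s \<omega>) $ i)
               (\<lambda>r. ennreal (normal_density 0 (sqrt (t - s)) r))))"

text \<open>``Adapted'' always includes joint measurability, so that time integrals make sense.\<close>

definition adapted_process ::
  "'w measure \<Rightarrow> (real \<Rightarrow> 'w measure) \<Rightarrow> real \<Rightarrow> (real \<Rightarrow> 'w \<Rightarrow> 'a::euclidean_space) \<Rightarrow> bool" where
  "adapted_process M F T X \<longleftrightarrow>
     (\<lambda>(t, \<omega>). X t \<omega>) \<in> borel_measurable (restrict_space borel {0..T} \<Otimes>\<^sub>M M) \<and>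
     (\<forall>t\<in>{0..T}. X t \<in> borel_measurable (F t))"

definition sup_square_integrable ::
  "'w measure \<Rightarrow> real \<Rightarrow> (real \<Rightarrow> 'w \<Rightarrow> 'a::euclidean_space) \<Rightarrow> bool" where
  "sup_square_integrable M T X \<longleftrightarrow>
     (\<integral>\<^sup>+\<omega>. (SUP t\<in>{0..T}. ennreal ((norm (X t \<omega>))\<^sup>2)) \<partial>M) < \<infinity>"

definition S2_process ::
  "'w measure \<Rightarrow> (real \<Rightarrow> 'w measure) \<Rightarrow> real \<Rightarrow> (real \<Rightarrow> 'w \<Rightarrow> 'a::euclidean_space) \<Rightarrow> bool" where
  "S2_process M F T X \<longleftrightarrow>
     adapted_process M F T X \<and> (AE \<omega> in M. continuous_on {0..T} (\<lambda>t. X t \<omega>)) \<and>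
     sup_square_integrable M T X"

definition M2_process ::
  "'w measure \<Rightarrow> (real \<Rightarrow> 'w measure) \<Rightarrow> real \<Rightarrow> (real \<Rightarrow> 'w \<Rightarrow> 'a::euclidean_space) \<Rightarrow> bool" where
  "M2_process M F T Z \<longleftrightarrow>
     adapted_process M F T Z \<and>
     (\<integral>\<^sup>+\<omega>. (\<integral>\<^sup>+t\<in>{0..T}. ennreal ((norm (Z t \<omega>))\<^sup>2) \<partial>lborel) \<partial>M) < \<infinity>"

text \<open>A simple integrand has the value \<open>\<zeta> i\<close> on \<open>(\<tau> i, \<tau> (i + 1)]\<close> for \<open>i < N\<close>
  and vanishes elsewhere. An \<open>m \<times> d\<close> matrix has the type \<open>real^'d^'m\<close>.\<close>

definition simple_integrand ::
  "(real \<Rightarrow> 'w measure) \<Rightarrow> real \<Rightarrow> nat \<Rightarrow> (nat \<Rightarrow> real) \<Rightarrow> (nat \<Rightarrow> 'w \<Rightarrow> real^'d^'m) \<Rightarrow> bool" where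
  "simple_integrand F T N \<tau> \<zeta> \<longleftrightarrow>
     (\<forall>i<N. 0 \<le> \<tau> i \<and> \<tau> i \<le> \<tau> (Suc i) \<and> \<tau> (Suc i) \<le> T) \<and>
     (\<forall>i<N. \<zeta> i \<in> borel_measurable (F (\<tau> i)) \<and>
        (\<exists>C. \<forall>\<omega>\<in>space (F (\<tau> i)). norm (\<zeta> i \<omega>) \<le> C))"

definition simple_process ::
  "nat \<Rightarrow> (nat \<Rightarrow> real) \<Rightarrow> (nat \<Rightarrow> 'w \<Rightarrow> real^'d^'m) \<Rightarrow> real \<Rightarrow> 'w \<Rightarrow> real^'d^'m" where
  "simple_process N \<tau> \<zeta> t \<omega> = (\<Sum>i<N. indicator {\<tau> i<..\<tau> (Suc i)} t *\<^sub>R \<zeta> i \<omega>)"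

definition simple_ito_integral ::
  "(real \<Rightarrow> 'w \<Rightarrow> real^'d) \<Rightarrow> nat \<Rightarrow> (nat \<Rightarrow> real) \<Rightarrow> (nat \<Rightarrow> 'w \<Rightarrow> real^'d^'m) \<Rightarrow>
     real \<Rightarrow> 'w \<Rightarrow> real^'m" where
  "simple_ito_integral W N \<tau> \<zeta> t \<omega> =
     (\<Sum>i<N. \<zeta> i \<omega> *v (W (min (\<tau> (Suc i)) t) \<omega> - W (min (\<tau> i) t) \<omega>))"

text \<open>\<open>I\<close> is a continuous version of the Ito integral process of \<open>Z\<close> with respect to \<open>W\<close>;
  it is determined up to indistinguishability.\<close>

definition has_ito_integral ::
  "'w measure \<Rightarrow> (real \<Rightarrow> 'w measure) \<Rightarrow> (real \<Rightarrow> 'w \<Rightarrow> real^'d) \<Rightarrow> real \<Rightarrow>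
     (real \<Rightarrow> 'w \<Rightarrow> real^'d^'m) \<Rightarrow> (real \<Rightarrow> 'w \<Rightarrow> real^'m) \<Rightarrow> bool" where
  "has_ito_integral M F W T Z I \<longleftrightarrow>
     M2_process M F T Z \<and> adapted_process M F T I \<and>
     (AE \<omega> in M. continuous_on {0..T} (\<lambda>t. I t \<omega>)) \<and>
     (\<exists>N \<tau> \<zeta>. (\<forall>j. simple_integrand F T (N j) (\<tau> j) (\<zeta> j)) \<and>
        ((\<lambda>j. \<integral>\<^sup>+\<omega>. (\<integral>\<^sup>+t\<in>{0..T}.
             ennreal ((norm (Z t \<omega> - simple_process (N j) (\<tau> j) (\<zeta> j) t \<omega>))\<^sup>2) \<partial>lborel) \<partial>M)
           \<longlonglongrightarrow> 0) \<and>
        (\<forall>t\<in>{0..T}. (\<lambda>j. \<integral>\<^sup>+\<omega>.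
             ennreal ((norm (I t \<omega> - simple_ito_integral W (N j) (\<tau> j) (\<zeta> j) t \<omega>))\<^sup>2) \<partial>M)
           \<longlonglongrightarrow> 0))"

text \<open>\<open>dX = a dt + B dW\<close> on \<open>[0,T]\<close>\<close>

definition ito_differential ::
  "'w measure \<Rightarrow> (real \<Rightarrow> 'w measure) \<Rightarrow> (real \<Rightarrow> 'w \<Rightarrow> real^'d) \<Rightarrow> real \<Rightarrow>
     (real \<Rightarrow> 'w \<Rightarrow> real^'m) \<Rightarrow> (real \<Rightarrow> 'w \<Rightarrow> real^'m) \<Rightarrow> (real \<Rightarrow> 'w \<Rightarrow> real^'d^'m) \<Rightarrow> bool" where
  "ito_differential M F W T X a B \<longleftrightarrow>
     adapted_process M F T a \<and>
     (AE \<omega> in M. set_integrable lborel {0..T} (\<lambda>t. a t \<omega>)) \<and>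
     (\<exists>I. has_ito_integral M F W T B I \<and>
        (AE \<omega> in M. \<forall>t\<in>{0..T}. X t \<omega> = X 0 \<omega> + (LINT s:{0..t}|lborel. a s \<omega>) + I t \<omega>))"

text \<open>Continuity of the derivative is required in the space and control variables only, for
  each fixed \<open>t\<close>; the bound is uniform in \<open>t\<close>.\<close>

definition C1_bounded_derivative ::
  "real \<Rightarrow> 'c::euclidean_space set \<Rightarrow>
     (real \<Rightarrow> 'a::euclidean_space \<Rightarrow> 'c \<Rightarrow> 'b::euclidean_space) \<Rightarrow> bool" where
  "C1_bounded_derivative T U \<phi> \<longleftrightarrow>
     (\<exists>D :: real \<Rightarrow> 'a \<Rightarrow> 'c \<Rightarrow> ('a \<Rightarrow>\<^sub>L 'b).
        (\<forall>t\<in>{0..T}. \<forall>v\<in>U. \<forall>a. ((\<lambda>a. \<phi> t a v) has_derivative blinfun_apply (D t a v)) (at a)) \<and>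
        (\<forall>t\<in>{0..T}. continuous_on (UNIV \<times> U) (\<lambda>(a, v). D t a v)) \<and>
        (\<exists>C. \<forall>t\<in>{0..T}. \<forall>v\<in>U. \<forall>a. norm (D t a v) \<le> C))"

text \<open>No regularity in \<open>t\<close> and no continuity of the data themselves in \<open>v\<close> is assumed; the
  Borel measurability clauses are what gives the coefficients along a trajectory a meaning.\<close>

definition standing_assumptions ::
  "real \<Rightarrow> (real^'k) set \<Rightarrow>
   (real \<Rightarrow> real^'n \<Rightarrow> real^'k \<Rightarrow> real^'n) \<Rightarrow>
   (real \<Rightarrow> real^'n \<Rightarrow> real^'k \<Rightarrow> real^'d^'n) \<Rightarrow>
   (real \<Rightarrow> real^'n \<Rightarrow> real^'m \<Rightarrow> real^'d^'m \<Rightarrow> real^'k \<Rightarrow> real^'m) \<Rightarrow>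
   (real^'n \<Rightarrow> real) \<Rightarrow> (real^'m \<Rightarrow> real) \<Rightarrow>
   (real \<Rightarrow> real^'n \<Rightarrow> real^'m \<Rightarrow> real^'d^'m \<Rightarrow> real^'k \<Rightarrow> real) \<Rightarrow> bool" where
  "standing_assumptions T U b \<sigma> f g h l \<longleftrightarrow>
     (\<lambda>(t, x, v). b t x v) \<in> borel_measurable (restrict_space borel ({0..T} \<times> UNIV \<times> U)) \<and>
     (\<lambda>(t, x, v). \<sigma> t x v) \<in> borel_measurable (restrict_space borel ({0..T} \<times> UNIV \<times> U)) \<and>
     (\<lambda>(t, x, y, z, v). f t x y z v)
        \<in> borel_measurable (restrict_space borel ({0..T} \<times> UNIV \<times> UNIV \<times> UNIV \<times> U)) \<and>
     (\<lambda>(t, x, y, z, v). l t x y z v)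
        \<in> borel_measurable (restrict_space borel ({0..T} \<times> UNIV \<times> UNIV \<times> UNIV \<times> U)) \<and>
     C1_bounded_derivative T U b \<and>
     C1_bounded_derivative T U \<sigma> \<and>
     C1_bounded_derivative T U (\<lambda>t (x, y, z) v. f t x y z v) \<and>
     C1_bounded_derivative T U (\<lambda>t x v. g x) \<and>
     C1_bounded_derivative T U (\<lambda>t y v. h y) \<and>
     C1_bounded_derivative T U (\<lambda>t (x, y, z) v. l t x y z v) \<and>
     (\<exists>C. \<forall>t\<in>{0..T}. \<forall>v\<in>U. \<forall>x y z.
        norm (b t x v) \<le> C * (1 + norm x + norm v) \<and>
        norm (\<sigma> t x v) \<le> C * (1 + norm x + norm v) \<and>
        norm (f t x y z v) \<le> C * (1 + norm x + norm y + norm z + norm v) \<and>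
        \<bar>g x\<bar> \<le> C * (1 + norm x) \<and>
        \<bar>h y\<bar> \<le> C * (1 + norm y) \<and>
        \<bar>l t x y z v\<bar> \<le> C * (1 + norm x + norm y + norm z + norm v)) \<and>
     (\<exists>C. \<forall>t\<in>{0..T}. \<forall>v\<in>U. \<forall>x y z.
        norm (b t x v) \<le> C \<and> norm (\<sigma> t x v) \<le> C \<and> norm (f t x y z v) \<le> C \<and>
        \<bar>l t x y z v\<bar> \<le> C)"

definition strict_controls ::
  "'w measure \<Rightarrow> (real \<Rightarrow> 'w measure) \<Rightarrow> real \<Rightarrow> (real^'k) set \<Rightarrow> (real \<Rightarrow> 'w \<Rightarrow> real^'k) set" where
  "strict_controls M F T U =
     {v. adapted_process M F T v \<and> (\<forall>t\<in>{0..T}. \<forall>\<omega>\<in>space M. v t \<omega> \<in> U) \<and>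
         sup_square_integrable M T v}"

definition state_equation ::
  "'w measure \<Rightarrow> (real \<Rightarrow> 'w measure) \<Rightarrow> (real \<Rightarrow> 'w \<Rightarrow> real^'d) \<Rightarrow> real \<Rightarrow>
   (real \<Rightarrow> real^'n \<Rightarrow> real^'k \<Rightarrow> real^'n) \<Rightarrow>
   (real \<Rightarrow> real^'n \<Rightarrow> real^'k \<Rightarrow> real^'d^'n) \<Rightarrow>
   (real \<Rightarrow> real^'n \<Rightarrow> real^'m \<Rightarrow> real^'d^'m \<Rightarrow> real^'k \<Rightarrow> real^'m) \<Rightarrow>
   ('w \<Rightarrow> real^'n) \<Rightarrow> ('w \<Rightarrow> real^'m) \<Rightarrow> (real \<Rightarrow> 'w \<Rightarrow> real^'k) \<Rightarrow>
   (real \<Rightarrow> 'w \<Rightarrow> real^'n) \<Rightarrow> (real \<Rightarrow> 'w \<Rightarrow> real^'m) \<Rightarrow> (real \<Rightarrow> 'w \<Rightarrow> real^'d^'m) \<Rightarrow> bool" where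
  "state_equation M F W T b \<sigma> f x0 \<xi> v x y z \<longleftrightarrow>
     S2_process M F T x \<and> S2_process M F T y \<and> M2_process M F T z \<and>
     ito_differential M F W T x (\<lambda>t \<omega>. b t (x t \<omega>) (v t \<omega>)) (\<lambda>t \<omega>. \<sigma> t (x t \<omega>) (v t \<omega>)) \<and>
     (AE \<omega> in M. x 0 \<omega> = x0 \<omega>) \<and>
     ito_differential M F W T y (\<lambda>t \<omega>. - f t (x t \<omega>) (y t \<omega>) (z t \<omega>) (v t \<omega>)) z \<and>
     (AE \<omega> in M. y T \<omega> = \<xi> \<omega>)"

definition cost ::
  "'w measure \<Rightarrow> real \<Rightarrow> (real^'n \<Rightarrow> real) \<Rightarrow> (real^'m \<Rightarrow> real) \<Rightarrow>
   (real \<Rightarrow> real^'n \<Rightarrow> real^'m \<Rightarrow> real^'d^'m \<Rightarrow> real^'k \<Rightarrow> real) \<Rightarrow> (real \<Rightarrow> 'w \<Rightarrow> real^'k) \<Rightarrow>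
   (real \<Rightarrow> 'w \<Rightarrow> real^'n) \<Rightarrow> (real \<Rightarrow> 'w \<Rightarrow> real^'m) \<Rightarrow> (real \<Rightarrow> 'w \<Rightarrow> real^'d^'m) \<Rightarrow> real" where
  "cost M T g h l v x y z =
     (\<integral>\<omega>. g (x T \<omega>) + h (y 0 \<omega>) +
        (LINT t:{0..T}|lborel. l t (x t \<omega>) (y t \<omega>) (z t \<omega>) (v t \<omega>)) \<partial>M)"

definition hamiltonian ::
  "(real \<Rightarrow> real^'n \<Rightarrow> real^'k \<Rightarrow> real^'n) \<Rightarrow>
   (real \<Rightarrow> real^'n \<Rightarrow> real^'k \<Rightarrow> real^'d^'n) \<Rightarrow>
   (real \<Rightarrow> real^'n \<Rightarrow> real^'m \<Rightarrow> real^'d^'m \<Rightarrow> real^'k \<Rightarrow> real^'m) \<Rightarrow>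
   (real \<Rightarrow> real^'n \<Rightarrow> real^'m \<Rightarrow> real^'d^'m \<Rightarrow> real^'k \<Rightarrow> real) \<Rightarrow>
   real \<Rightarrow> real^'n \<Rightarrow> real^'m \<Rightarrow> real^'d^'m \<Rightarrow> real^'k \<Rightarrow>
   real^'m \<Rightarrow> real^'n \<Rightarrow> real^'d^'n \<Rightarrow> real" where
  "hamiltonian b \<sigma> f l t x y z v k p P =
     l t x y z v + p \<bullet> b t x v + P \<bullet> \<sigma> t x v + k \<bullet> f t x y z v"

definition gradient :: "('a::euclidean_space \<Rightarrow> real) \<Rightarrow> 'a \<Rightarrow> 'a" where
  "gradient \<phi> a = (THE D. GDERIV \<phi> a :> D)"

definition adjoint_equation ::
  "'w measure \<Rightarrow> (real \<Rightarrow> 'w measure) \<Rightarrow> (real \<Rightarrow> 'w \<Rightarrow> real^'d) \<Rightarrow> real \<Rightarrow>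
   (real \<Rightarrow> real^'n \<Rightarrow> real^'m \<Rightarrow> real^'d^'m \<Rightarrow> real^'k \<Rightarrow>
      real^'m \<Rightarrow> real^'n \<Rightarrow> real^'d^'n \<Rightarrow> real) \<Rightarrow>
   (real^'n \<Rightarrow> real) \<Rightarrow> (real^'m \<Rightarrow> real) \<Rightarrow> (real \<Rightarrow> 'w \<Rightarrow> real^'k) \<Rightarrow>
   (real \<Rightarrow> 'w \<Rightarrow> real^'n) \<Rightarrow> (real \<Rightarrow> 'w \<Rightarrow> real^'m) \<Rightarrow> (real \<Rightarrow> 'w \<Rightarrow> real^'d^'m) \<Rightarrow>
   (real \<Rightarrow> 'w \<Rightarrow> real^'m) \<Rightarrow> (real \<Rightarrow> 'w \<Rightarrow> real^'n) \<Rightarrow> (real \<Rightarrow> 'w \<Rightarrow> real^'d^'n) \<Rightarrow> bool" where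
  "adjoint_equation M F W T H g h u x y z k p P \<longleftrightarrow>
     S2_process M F T k \<and> S2_process M F T p \<and> M2_process M F T P \<and>
     ito_differential M F W T k
       (\<lambda>t \<omega>. gradient (\<lambda>\<eta>. H t (x t \<omega>) \<eta> (z t \<omega>) (u t \<omega>) (k t \<omega>) (p t \<omega>) (P t \<omega>)) (y t \<omega>))
       (\<lambda>t \<omega>. gradient (\<lambda>\<zeta>. H t (x t \<omega>) (y t \<omega>) \<zeta> (u t \<omega>) (k t \<omega>) (p t \<omega>) (P t \<omega>)) (z t \<omega>)) \<and>
     (AE \<omega> in M. k 0 \<omega> = gradient h (y 0 \<omega>)) \<and>
     ito_differential M F W T p
       (\<lambda>t \<omega>. - gradient (\<lambda>\<theta>. H t \<theta> (y t \<omega>) (z t \<omega>) (u t \<omega>) (k t \<omega>) (p t \<omega>) (P t \<omega>)) (x t \<omega>))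
       P \<and>
     (AE \<omega> in M. p T \<omega> = gradient g (x T \<omega>))"

end

theory Submission
  imports Defs
begin

text \<open>A bounded convex function on a vector space is constant. The Hamiltonian is convex in
  \<open>(x, y, z)\<close> for every value of \<open>(k, p, P)\<close>, and \<open>b\<close>, \<open>\<sigma>\<close>, \<open>f\<close>, \<open>l\<close> are bounded; varying
  \<open>(k, p, P)\<close> shows that none of these coefficients depends on \<open>(x, y, z)\<close>. Hence
  \<open>H\<^sub>x = H\<^sub>y = H\<^sub>z = 0\<close>, the process \<open>k\<close> is constant in time and \<open>dp = P dW\<close>. Convexity of \<open>g\<close>
  and \<open>h\<close> bounds \<open>J(v) - J(u)\<close> from below by
  \<open>E[p\<^sub>T (x\<^sup>v\<^sub>T - x\<^sup>u\<^sub>T)] + E[k\<^sub>0 (y\<^sup>v\<^sub>0 - y\<^sup>u\<^sub>0)] + E \<integral> (l\<^sup>v - l\<^sup>u) dt\<close>. Both products are computed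
  from the martingale property and the Ito isometry alone, without Ito's product formula, because
  \<open>p\<close> and \<open>k\<close> have no drift; the sum is \<open>E \<integral> (H(v) - H(u)) dt\<close>, which is nonnegative.\<close>

section \<open>Convex functions and gradients\<close>

text \<open>Pairing \<open>p\<close> with the state at \<open>T\<close> normally calls for the
  product rule. Here \<open>p\<close> is \<open>p 0\<close> plus a stochastic integral, so
  \<open>p T\<close> can be replaced by \<open>p t\<close> against a drift that is known at time
  \<open>t\<close>, and the two stochastic integrals meet only through their covariance. That
  covariance involves two integrands with unrelated approximating partitions; instead of refining
  them to a common one, the isometry is proved in bilinear form, for two increments over arbitrarily
  overlapping intervals. Conditional expectations are avoided as well: the martingale property is
  tested against every square-integrable \<open>Y\<close> measurable for \<open>F s\<close>, a form
  that survives L2 limits. All limits take place in L2 of \<open>M\<close> or of the product of time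
  and \<open>M\<close>. For \<open>y\<close> the data sit at the opposite end: \<open>\<xi>\<close>
  is common to all controls, and constancy of \<open>k\<close> carries the gradient of
  \<open>h\<close> from time 0 to time \<open>T\<close>. The last step uses constancy of the
  coefficients once more: those along the trajectory of \<open>v\<close> may be evaluated at that of
  \<open>u\<close>, which is where the minimum condition is given.\<close>

lemma bounded_convex_imp_const:
  fixes \<phi> :: "'a::real_vector \<Rightarrow> real"
  assumes cvx: "convex_on UNIV \<phi>" and bd: "\<And>a. \<bar>\<phi> a\<bar> \<le> C"
  shows "\<phi> a = \<phi> a'"
proof -
  have le: "\<phi> y \<le> \<phi> x" for x y
  proof (rule ccontr)
    assume "\<not> \<phi> y \<le> \<phi> x"
    then have pos: "\<phi> y - \<phi> x > 0" by simp
    \<comment> \<open>Two values of \<open>\<phi>\<close> differ by at most \<open>2 * C\<close>.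
      Going from \<open>x\<close> through \<open>y\<close> to \<open>n\<close> times the distance,
      convexity makes the excess grow at least \<open>n\<close>-fold, which overshoots this
      bound.\<close>
    then obtain n :: nat where n: "2 * C < n * (\<phi> y - \<phi> x)"
      using reals_Archimedean3 by blast
    have "0 \<le> C" using bd[of x] by linarith
    with n pos have "n > 0" by (cases n) auto
    define w where "w = x + real n *\<^sub>R (y - x)"
    have "y = (1 - 1 / n) *\<^sub>R x + (1 / n) *\<^sub>R w"
      using \<open>n > 0\<close> by (simp add: w_def algebra_simps)
    then have "\<phi> y \<le> (1 - 1 / n) * \<phi> x + (1 / n) * \<phi> w"
      using convex_onD[OF cvx, of "1 / n" x w] \<open>n > 0\<close> by simp
    then have "n * (\<phi> y - \<phi> x) \<le> \<phi> w - \<phi> x"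
      using \<open>n > 0\<close> by (simp add: field_simps)
    then show False
      using n bd[of w] bd[of x] by linarith
  qed
  show ?thesis using le[of a a'] le[of a' a] by (rule antisym)
qed

text \<open>\<open>gradient\<close> is a definite description, so a value follows only from
  uniqueness of the Frechet derivative: two representing vectors have the same inner product with
  every direction.\<close>

lemma gradient_eqI: "GDERIV \<phi> a :> D \<Longrightarrow> gradient \<phi> a = D"
  for \<phi> :: "'a::euclidean_space \<Rightarrow> real"
  unfolding gradient_def
proof (rule the_equality)
  fix D' assume "GDERIV \<phi> a :> D" "GDERIV \<phi> a :> D'"
  then have "(\<lambda>h. h \<bullet> D) = (\<lambda>h. h \<bullet> D')"
    unfolding gderiv_def by (rule has_derivative_unique)
  then have "h \<bullet> D' = h \<bullet> D" for h by (simp add: fun_eq_iff)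
  then show "D' = D" using vector_eq_ldot[of D' D] by blast
qed

lemma gradient_const [simp]: "gradient (\<lambda>_. c) a = 0"
  by (rule gradient_eqI) (rule GDERIV_const)

text \<open>Riesz representation in finite dimension: the coefficients of the gradient are the
  values of the derivative on \<open>Basis\<close>. It links the derivatives of \<open>g\<close> and
  \<open>h\<close> to the gradients in the adjoint equation.\<close>

lemma gradient_has_derivative:
  fixes \<phi> :: "'a::euclidean_space \<Rightarrow> real"
  assumes "(\<phi> has_derivative \<phi>') (at a)"
  shows "(\<phi> has_derivative (\<lambda>h. h \<bullet> gradient \<phi> a)) (at a)"
proof -
  interpret linear \<phi>' using assms by (rule has_derivative_linear)
  have "\<phi>' h = h \<bullet> (\<Sum>e\<in>Basis. \<phi>' e *\<^sub>R e)" for h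
    by (subst euclidean_representation[of h, symmetric], subst sum)
       (simp add: scale inner_sum_right mult.commute)
  then have "\<phi>' = (\<lambda>h. h \<bullet> (\<Sum>e\<in>Basis. \<phi>' e *\<^sub>R e))" by (rule ext)
  then have D: "GDERIV \<phi> a :> (\<Sum>e\<in>Basis. \<phi>' e *\<^sub>R e)"
    using assms unfolding gderiv_def by simp
  then show ?thesis
    unfolding gradient_eqI[OF D] gderiv_def .
qed

text \<open>Restricting \<open>\<phi>\<close> to the line through \<open>a\<close> and
  \<open>a'\<close> reduces the claim to the tangent inequality for a convex function of one real
  variable, with the tangent at parameter 0 compared at parameter 1.\<close>

lemma convex_above_gradient:
  fixes \<phi> :: "'a::euclidean_space \<Rightarrow> real"
  assumes cvx: "convex_on UNIV \<phi>" and diff: "(\<phi> has_derivative \<phi>') (at a)"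
  shows "gradient \<phi> a \<bullet> (a' - a) \<le> \<phi> a' - \<phi> a"
proof -
  let ?\<psi> = "\<lambda>t. \<phi> (a + t *\<^sub>R (a' - a))"
  have "convex_on UNIV ?\<psi>"
  proof (rule convex_onI)
    fix t s r :: real assume t: "0 < t" "t < 1"
    have "a + ((1 - t) *\<^sub>R s + t *\<^sub>R r) *\<^sub>R (a' - a) =
      (1 - t) *\<^sub>R (a + s *\<^sub>R (a' - a)) + t *\<^sub>R (a + r *\<^sub>R (a' - a))"
      by (simp add: algebra_simps)
    then show "?\<psi> ((1 - t) *\<^sub>R s + t *\<^sub>R r) \<le> (1 - t) * ?\<psi> s + t * ?\<psi> r"
      using convex_onD[OF cvx, of t] t by simp
  qed simp
  moreover have "((\<lambda>t. a + t *\<^sub>R (a' - a)) has_derivative (\<lambda>s. s *\<^sub>R (a' - a))) (at 0)"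
    by (auto intro!: derivative_eq_intros)
  then have "(?\<psi> has_derivative (\<lambda>s. (s *\<^sub>R (a' - a)) \<bullet> gradient \<phi> a)) (at 0)"
    by (rule has_derivative_compose) (simp add: gradient_has_derivative[OF diff])
  then have "(?\<psi> has_field_derivative gradient \<phi> a \<bullet> (a' - a)) (at 0)"
    unfolding has_field_derivative_def
    by (rule has_derivative_eq_rhs) (simp add: inner_commute mult.commute fun_eq_iff)
  ultimately have "gradient \<phi> a \<bullet> (a' - a) * (1 - 0) \<le> ?\<psi> 1 - ?\<psi> 0"
    by (intro convex_on_imp_above_tangent[of UNIV]) auto
  then show ?thesis by simp
qed

section \<open>Square-integrable functions\<close>

text \<open>Membership in L2, over an arbitrary measure because it serves both for random variables
  over \<open>M\<close> and for processes over the product of \<open>{0..T}\<close> and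
  \<open>M\<close>.\<close>

definition sq_integrable :: "'a measure \<Rightarrow> ('a \<Rightarrow> 'b::euclidean_space) \<Rightarrow> bool" where
  "sq_integrable N X \<longleftrightarrow> X \<in> borel_measurable N \<and> integrable N (\<lambda>s. (norm (X s))\<^sup>2)"

lemma sq_integrable_measurable: "sq_integrable N X \<Longrightarrow> X \<in> borel_measurable N"
  by (simp add: sq_integrable_def)

lemma sq_integrable_norm: "sq_integrable N X \<Longrightarrow> integrable N (\<lambda>s. (norm (X s))\<^sup>2)"
  by (simp add: sq_integrable_def)

lemma sq_integrableI:
  assumes "X \<in> borel_measurable N" "(\<integral>\<^sup>+s. ennreal ((norm (X s))\<^sup>2) \<partial>N) < \<infinity>"
  shows "sq_integrable N X"
  using assms by (auto simp: sq_integrable_def integrable_iff_bounded)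

lemma sq_integrable_dominated:
  assumes "X \<in> borel_measurable N" "integrable N G" "\<And>s. (norm (X s))\<^sup>2 \<le> G s"
  shows "sq_integrable N X"
  unfolding sq_integrable_def
  using assms(1) by (auto intro: Bochner_Integration.integrable_bound[OF assms(2)]
    simp: order_trans[OF assms(3) abs_ge_self])

lemma sq_integrable_inner:
  assumes "sq_integrable N X" "sq_integrable N Y"
  shows "integrable N (\<lambda>s. X s \<bullet> Y s)"
proof (rule Bochner_Integration.integrable_bound)
  show "integrable N (\<lambda>s. (norm (X s))\<^sup>2 + (norm (Y s))\<^sup>2)"
    using assms by (simp add: sq_integrable_norm)
  show "(\<lambda>s. X s \<bullet> Y s) \<in> borel_measurable N"
    using assms[THEN sq_integrable_measurable] by simp
  have "\<bar>X s \<bullet> Y s\<bar> \<le> (norm (X s))\<^sup>2 + (norm (Y s))\<^sup>2" for s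
  proof -
    have "\<bar>X s \<bullet> Y s\<bar> \<le> norm (X s) * norm (Y s)" by (rule Cauchy_Schwarz_ineq2)
    also have "\<dots> \<le> (norm (X s))\<^sup>2 + (norm (Y s))\<^sup>2"
      using sum_squares_bound[of "norm (X s)" "norm (Y s)"] norm_ge_zero[of "X s"]
        norm_ge_zero[of "Y s"] mult_nonneg_nonneg[of "norm (X s)" "norm (Y s)"] by linarith
    finally show ?thesis .
  qed
  then show "AE s in N. norm (X s \<bullet> Y s) \<le> norm ((norm (X s))\<^sup>2 + (norm (Y s))\<^sup>2)" by simp
qed

lemma sq_integrable_add:
  assumes "sq_integrable N X" "sq_integrable N Y"
  shows "sq_integrable N (\<lambda>s. X s + Y s)"
proof (rule sq_integrable_dominated)
  show "(\<lambda>s. X s + Y s) \<in> borel_measurable N"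
    using assms[THEN sq_integrable_measurable] by simp
  show "integrable N (\<lambda>s. (norm (X s))\<^sup>2 + 2 * (X s \<bullet> Y s) + (norm (Y s))\<^sup>2)"
    using assms by (simp add: sq_integrable_norm sq_integrable_inner)
  show "(norm (X s + Y s))\<^sup>2 \<le> (norm (X s))\<^sup>2 + 2 * (X s \<bullet> Y s) + (norm (Y s))\<^sup>2" for s
    by (simp add: power2_norm_eq_inner inner_simps inner_commute)
qed

lemma sq_integrable_minus: "sq_integrable N X \<Longrightarrow> sq_integrable N (\<lambda>s. - X s)"
  by (auto simp: sq_integrable_def)

lemma sq_integrable_diff:
  "sq_integrable N X \<Longrightarrow> sq_integrable N Y \<Longrightarrow> sq_integrable N (\<lambda>s. X s - Y s)"
  using sq_integrable_add[OF _ sq_integrable_minus, of N X Y] by simp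

lemma sq_integrable_sum:
  "(\<And>i. i \<in> A \<Longrightarrow> sq_integrable N (X i)) \<Longrightarrow> sq_integrable N (\<lambda>s. \<Sum>i\<in>A. X i s)"
proof (induction A rule: infinite_finite_induct)
  case (insert i A)
  then show ?case using sq_integrable_add[of N "X i"] by simp
qed (auto simp: sq_integrable_def)

lemma vec_nth_measurable:
  "(\<lambda>a :: ('b::euclidean_space)^'n. a $ i) \<in> borel_measurable borel"
  by (intro borel_measurable_continuous_onI linear_continuous_on bounded_linear_vec_nth)

lemma sq_integrable_nth:
  fixes X :: "'a \<Rightarrow> ('b::euclidean_space)^'n"
  assumes X: "sq_integrable N X"
  shows "sq_integrable N (\<lambda>s. X s $ i)"
proof (rule sq_integrable_dominated)
  show "(\<lambda>s. X s $ i) \<in> borel_measurable N"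
    by (rule measurable_compose[OF sq_integrable_measurable[OF X] vec_nth_measurable])
  show "integrable N (\<lambda>s. (norm (X s))\<^sup>2)"
    using X by (rule sq_integrable_norm)
  show "(norm (X s $ i))\<^sup>2 \<le> (norm (X s))\<^sup>2" for s
    by (intro power_mono Finite_Cartesian_Product.norm_nth_le norm_ge_zero)
qed

lemma sq_integrable_scaleR_left:
  "sq_integrable N X \<Longrightarrow> sq_integrable N (\<lambda>s. X s *\<^sub>R c)" for X :: "'a \<Rightarrow> real"
  by (auto simp: sq_integrable_def power_mult_distrib)

lemma sq_integrable_vecI:
  fixes X :: "'a \<Rightarrow> real^'n"
  assumes "\<And>i. sq_integrable N (\<lambda>s. X s $ i)"
  shows "sq_integrable N X"
proof -
  have "(\<Sum>i\<in>UNIV. X s $ i *\<^sub>R axis i 1) = X s" for s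
    using basis_expansion[of "X s"] by (simp add: scalar_mult_eq_scaleR)
  moreover have "sq_integrable N (\<lambda>s. \<Sum>i\<in>UNIV. X s $ i *\<^sub>R axis i (1::real))"
    by (intro sq_integrable_sum sq_integrable_scaleR_left assms)
  ultimately show ?thesis by simp
qed

lemma (in finite_measure) sq_integrable_bounded:
  assumes "X \<in> borel_measurable M" "\<And>s. s \<in> space M \<Longrightarrow> norm (X s) \<le> C"
  shows "sq_integrable M X"
  unfolding sq_integrable_def
  using assms by (auto intro!: integrable_const_bound[where B = "C\<^sup>2"] AE_I2 power_mono)

text \<open>After the pointwise inequality only the scalar functions \<open>norm (X s)\<close> and
  \<open>norm (Y s)\<close> remain. The estimate for nonnegative integrals applies to them, and
  square integrability makes its extended values real.\<close>

lemma sq_integrable_Cauchy_Schwarz: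
  assumes X: "sq_integrable N X" and Y: "sq_integrable N Y"
  shows "\<bar>\<integral>s. X s \<bullet> Y s \<partial>N\<bar> \<le> sqrt (\<integral>s. (norm (X s))\<^sup>2 \<partial>N) * sqrt (\<integral>s. (norm (Y s))\<^sup>2 \<partial>N)"
proof -
  have [measurable]: "X \<in> borel_measurable N" "Y \<in> borel_measurable N"
    using X Y by (auto simp: sq_integrable_measurable)
  have int: "integrable N (\<lambda>s. norm (X s) * norm (Y s))"
    using sq_integrable_inner[of N "\<lambda>s. norm (X s)" "\<lambda>s. norm (Y s)"] X Y
    by (simp add: sq_integrable_def)
  have "(\<integral>\<^sup>+s. ennreal (norm (X s)) * ennreal (norm (Y s)) \<partial>N)\<^sup>2 \<le>
      (\<integral>\<^sup>+s. ennreal (norm (X s)) ^ 2 \<partial>N) * (\<integral>\<^sup>+s. ennreal (norm (Y s)) ^ 2 \<partial>N)"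
    by (rule Cauchy_Schwarz_nn_integral) auto
  then have "ennreal ((\<integral>s. norm (X s) * norm (Y s) \<partial>N)\<^sup>2) \<le>
      ennreal ((\<integral>s. (norm (X s))\<^sup>2 \<partial>N) * (\<integral>s. (norm (Y s))\<^sup>2 \<partial>N))"
    by (simp add: ennreal_mult'[symmetric] ennreal_power nn_integral_eq_integral[OF int]
      nn_integral_eq_integral[OF sq_integrable_norm] X Y integral_nonneg ennreal_mult[symmetric])
  then have "(\<integral>s. norm (X s) * norm (Y s) \<partial>N)\<^sup>2 \<le>
      (\<integral>s. (norm (X s))\<^sup>2 \<partial>N) * (\<integral>s. (norm (Y s))\<^sup>2 \<partial>N)"
    by (subst (asm) ennreal_le_iff) (auto intro!: mult_nonneg_nonneg integral_nonneg)
  then have "(\<integral>s. norm (X s) * norm (Y s) \<partial>N) \<le>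
      sqrt ((\<integral>s. (norm (X s))\<^sup>2 \<partial>N) * (\<integral>s. (norm (Y s))\<^sup>2 \<partial>N))"
    by (rule real_le_rsqrt)
  moreover have "\<bar>\<integral>s. X s \<bullet> Y s \<partial>N\<bar> \<le> (\<integral>s. \<bar>X s \<bullet> Y s\<bar> \<partial>N)"
    by (rule integral_abs_bound)
  moreover have "(\<integral>s. \<bar>X s \<bullet> Y s\<bar> \<partial>N) \<le> (\<integral>s. norm (X s) * norm (Y s) \<partial>N)"
    using sq_integrable_inner[OF X Y] int by (intro integral_mono Cauchy_Schwarz_ineq2) auto
  ultimately show ?thesis unfolding real_sqrt_mult by linarith
qed

text \<open>Joint continuity of the L2 inner product, by which identities for simple integrands pass
  to general ones. The limits are stated with nonnegative integrals because
  \<open>has_ito_integral\<close> states them so.\<close>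

lemma sq_integrable_inner_tendsto:
  assumes X: "sq_integrable N X" "\<And>j. sq_integrable N (X' j)"
    and Y: "sq_integrable N Y" "\<And>j. sq_integrable N (Y' j)"
    and limX: "(\<lambda>j. \<integral>\<^sup>+s. ennreal ((norm (X s - X' j s))\<^sup>2) \<partial>N) \<longlonglongrightarrow> 0"
    and limY: "(\<lambda>j. \<integral>\<^sup>+s. ennreal ((norm (Y s - Y' j s))\<^sup>2) \<partial>N) \<longlonglongrightarrow> 0"
  shows "(\<lambda>j. \<integral>s. X' j s \<bullet> Y' j s \<partial>N) \<longlonglongrightarrow> (\<integral>s. X s \<bullet> Y s \<partial>N)"
proof -
  define A where "A j = (\<integral>s. (norm (X s - X' j s))\<^sup>2 \<partial>N)" for j
  define B where "B j = (\<integral>s. (norm (Y s - Y' j s))\<^sup>2 \<partial>N)" for j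
  have dX: "sq_integrable N (\<lambda>s. X s - X' j s)" and dY: "sq_integrable N (\<lambda>s. Y s - Y' j s)" for j
    using X Y by (auto intro: sq_integrable_diff)
  have "A \<longlonglongrightarrow> 0"
    using limX unfolding A_def
    by (simp add: nn_integral_eq_integral[OF sq_integrable_norm[OF dX]] integral_nonneg
      ennreal_tendsto_0_iff)
  moreover have "B \<longlonglongrightarrow> 0"
    using limY unfolding B_def
    by (simp add: nn_integral_eq_integral[OF sq_integrable_norm[OF dY]] integral_nonneg
      ennreal_tendsto_0_iff)
  ultimately have *: "(\<lambda>j. sqrt (A j) * sqrt (\<integral>s. (norm (Y s))\<^sup>2 \<partial>N) +
      sqrt (\<integral>s. (norm (X s))\<^sup>2 \<partial>N) * sqrt (B j) + sqrt (A j) * sqrt (B j)) \<longlonglongrightarrow>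
      sqrt 0 * sqrt (\<integral>s. (norm (Y s))\<^sup>2 \<partial>N) + sqrt (\<integral>s. (norm (X s))\<^sup>2 \<partial>N) * sqrt 0 + sqrt 0 * sqrt 0"
    by (intro tendsto_intros)
  have "norm ((\<integral>s. X' j s \<bullet> Y' j s \<partial>N) - (\<integral>s. X s \<bullet> Y s \<partial>N)) \<le>
      sqrt (A j) * sqrt (\<integral>s. (norm (Y s))\<^sup>2 \<partial>N) +
      sqrt (\<integral>s. (norm (X s))\<^sup>2 \<partial>N) * sqrt (B j) + sqrt (A j) * sqrt (B j)" for j
  proof -
    have "(\<integral>s. X' j s \<bullet> Y' j s \<partial>N) - (\<integral>s. X s \<bullet> Y s \<partial>N) =
      (\<integral>s. X' j s \<bullet> Y' j s - X s \<bullet> Y s \<partial>N)"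
      using X Y by (simp add: sq_integrable_inner)
    \<comment> \<open>Every term now contains a difference tending to 0 in L2, so Cauchy-Schwarz
      bounds each one separately.\<close>
    also have "\<dots> = (\<integral>s. (X s - X' j s) \<bullet> (Y s - Y' j s) - (X s - X' j s) \<bullet> Y s
       - X s \<bullet> (Y s - Y' j s) \<partial>N)"
      by (rule Bochner_Integration.integral_cong) (auto simp: inner_simps)
    also have "\<dots> = (\<integral>s. (X s - X' j s) \<bullet> (Y s - Y' j s) \<partial>N) - (\<integral>s. (X s - X' j s) \<bullet> Y s \<partial>N)
       - (\<integral>s. X s \<bullet> (Y s - Y' j s) \<partial>N)"
      using X Y dX dY by (simp add: sq_integrable_inner)
    finally show ?thesis
      using sq_integrable_Cauchy_Schwarz[OF dX dY, of j j]
        sq_integrable_Cauchy_Schwarz[OF dX Y(1), of j] sq_integrable_Cauchy_Schwarz[OF X(1) dY, of j]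
      unfolding A_def B_def by simp
  qed
  then have "\<forall>\<^sub>F j in sequentially. norm ((\<integral>s. X' j s \<bullet> Y' j s \<partial>N) - (\<integral>s. X s \<bullet> Y s \<partial>N)) \<le>
      sqrt (A j) * sqrt (\<integral>s. (norm (Y s))\<^sup>2 \<partial>N) +
      sqrt (\<integral>s. (norm (X s))\<^sup>2 \<partial>N) * sqrt (B j) + sqrt (A j) * sqrt (B j)"
    by (rule always_eventually[OF allI])
  from Lim_null_comparison[OF this] *
  have "(\<lambda>j. (\<integral>s. X' j s \<bullet> Y' j s \<partial>N) - (\<integral>s. X s \<bullet> Y s \<partial>N)) \<longlonglongrightarrow> 0"
    by simp
  then show ?thesis by (rule LIM_zero_cancel)
qed

section \<open>Moments of Brownian increments\<close>

locale brownian_space = prob_space M for M :: "'w measure" +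
  fixes F :: "real \<Rightarrow> 'w measure" and W :: "real \<Rightarrow> 'w \<Rightarrow> real^'d"
  assumes filtr: "filtration (space M) F"
    and subalg: "\<And>t. subalgebra M (F t)"
    and brownian: "brownian_motion M F W"
begin

lemma space_F [simp]: "space (F t) = space M"
  using subalg[of t] by (simp add: subalgebra_def)

lemma F_measurable: "X \<in> borel_measurable (F t) \<Longrightarrow> X \<in> borel_measurable M"
  using measurable_from_subalg[OF subalg] .

lemma F_measurable_mono:
  assumes "X \<in> borel_measurable (F s)" "s \<le> t"
  shows "X \<in> borel_measurable (F t)"
proof -
  have "subalgebra (F t) (F s)"
    using filtration.sets_F_mono[OF filtr \<open>s \<le> t\<close>] by (simp add: subalgebra_def)
  from measurable_from_subalg[OF this assms(1)] show ?thesis .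
qed

lemma W_measurable: "0 \<le> t \<Longrightarrow> W t \<in> borel_measurable (F t)"
  using brownian by (simp add: brownian_motion_def)

text \<open>Real-valued coordinates are isolated because the Gaussian law and the independence of
  the components are given coordinatewise.\<close>

definition incr :: "'d \<Rightarrow> real \<Rightarrow> real \<Rightarrow> 'w \<Rightarrow> real" where
  "incr i s t \<omega> = (W t \<omega> - W s \<omega>) $ i"

lemma increment_measurable:
  assumes "0 \<le> s" "s \<le> t"
  shows "(\<lambda>\<omega>. W t \<omega> - W s \<omega>) \<in> borel_measurable (F t)"
  using assms W_measurable[of t] F_measurable_mono[OF W_measurable[of s], of t]
  by (intro borel_measurable_diff) auto

lemma incr_measurable:
  assumes "0 \<le> s" "s \<le> t"
  shows "incr i s t \<in> borel_measurable (F t)"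
  using measurable_compose[OF increment_measurable[OF assms] vec_nth_measurable, of i]
  by (simp add: incr_def[abs_def])

lemma incr_same [simp]: "incr i s s \<omega> = 0"
  by (simp add: incr_def)

lemma incr_add: "incr i s r \<omega> + incr i r t \<omega> = incr i s t \<omega>"
  by (simp add: incr_def)

text \<open>On the diagonal the second moment is the Gaussian variance \<open>t - s\<close>; off it
  the coordinates are independent and centred.\<close>

lemma incr_moments:
  assumes st: "0 \<le> s" "s \<le> t"
  shows sq_integrable_incr: "sq_integrable M (incr i s t)"
    and expectation_incr: "expectation (incr i s t) = 0"
    and expectation_incr_incr:
      "expectation (\<lambda>\<omega>. incr i s t \<omega> * incr j s t \<omega>) = (if i = j then t - s else 0)"
proof -
  have *: "sq_integrable M (incr i s t) \<and> expectation (incr i s t) = 0 \<and>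
    expectation (\<lambda>\<omega>. (incr i s t \<omega>)\<^sup>2) = t - s" for i
  proof (cases "s = t")
    \<comment> \<open>A Gaussian of variance 0 has no density, and \<open>brownian_motion\<close>
      speaks of \<open>s < t\<close> only, so the zero increment is treated apart.\<close>
    case True
    then show ?thesis by (simp add: incr_def[abs_def] sq_integrable_def)
  next
    case False
    with st have "s < t" by simp
    then have D: "distributed M lborel (incr i s t) (\<lambda>r. ennreal (normal_density 0 (sqrt (t - s)) r))"
      using brownian st unfolding brownian_motion_def incr_def[abs_def] by blast
    have pos: "0 < sqrt (t - s)" using \<open>s < t\<close> by simp
    have E: "expectation (incr i s t) = 0"
      using normal_distributed_expectation[OF pos D] .
    have "expectation (\<lambda>\<omega>. (incr i s t \<omega>)\<^sup>2) = t - s"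
      using normal_distributed_variance[OF pos D] \<open>s < t\<close> by (simp add: E)
    moreover have "integrable M (\<lambda>\<omega>. (incr i s t \<omega>)\<^sup>2)"
      using integrable_normal_moment[OF pos, of 0 2] distributed_integrable[OF D, of "\<lambda>x. x\<^sup>2"]
      by simp
    ultimately show ?thesis
      using E F_measurable[OF incr_measurable[OF st]] by (simp add: sq_integrable_def)
  qed
  then show sq: "sq_integrable M (incr i s t)" and E: "expectation (incr i s t) = 0" for i by auto
  show "expectation (\<lambda>\<omega>. incr i s t \<omega> * incr j s t \<omega>) = (if i = j then t - s else 0)"
  proof (cases "i = j \<or> s = t")
    case True
    then show ?thesis using * by (auto simp: power2_eq_square)
  next
    case False
    then have "indep_vars (\<lambda>_. borel) (\<lambda>i \<omega>. (W t \<omega> - W s \<omega>) $ i) UNIV"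
      using brownian st unfolding brownian_motion_def by fastforce
    then have ind: "indep_vars (\<lambda>_. borel) (\<lambda>i. incr i s t) {i, j}"
      unfolding incr_def[abs_def] by (rule indep_vars_subset) simp
    have int: "integrable M (incr i s t)" for i
      using sq_integrable_inner[OF sq[of i], of "\<lambda>_. 1"] by (simp add: sq_integrable_def)
    show ?thesis
      using indep_vars_lebesgue_integral[OF _ ind] int E False by simp
  qed
qed

lemma integrable_incr_incr:
  assumes "0 \<le> s" "s \<le> t"
  shows "integrable M (\<lambda>\<omega>. incr i s t \<omega> * incr j s t \<omega>)"
  using sq_integrable_inner[OF sq_integrable_incr[OF assms] sq_integrable_incr[OF assms]] by simp

lemma integrable_incr:
  assumes "0 \<le> s" "s \<le> t"
  shows "integrable M (incr i s t)"
  using sq_integrable_inner[OF sq_integrable_incr[OF assms], of "\<lambda>_. 1"]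
  by (simp add: sq_integrable_def)

text \<open>Both generated sigma-algebras sit inside ones that \<open>brownian_motion\<close>
  declares independent: that of \<open>Y\<close> inside \<open>F s\<close>, that of
  \<open>\<phi>\<close> of the increment inside the one generated by the whole vector. Later
  \<open>\<phi>\<close> is one coordinate or a product of two.\<close>

lemma indep_increment:
  fixes \<phi> :: "real^'d \<Rightarrow> real" and Y :: "'w \<Rightarrow> real"
  assumes st: "0 \<le> s" "s < t" and Y: "Y \<in> borel_measurable (F s)" and \<phi>: "\<phi> \<in> borel_measurable borel"
  shows "indep_var borel Y borel (\<lambda>\<omega>. \<phi> (W t \<omega> - W s \<omega>))"
  unfolding indep_var_eq
proof (intro conjI)
  let ?D = "\<lambda>\<omega>. W t \<omega> - W s \<omega>"
  let ?V = "vimage_algebra (space M) ?D borel"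
  show "random_variable borel Y" using Y by (rule F_measurable)
  have D: "?D \<in> borel_measurable M"
    using increment_measurable[of s t] st by (intro F_measurable) auto
  then show "random_variable borel (\<lambda>\<omega>. \<phi> (?D \<omega>))" using \<phi> by (rule measurable_compose)
  have ind: "indep_set (sets (F s)) (sets ?V)"
    using brownian st unfolding brownian_motion_def by blast
  have "{Y -` A \<inter> space M |A. A \<in> sets borel} \<subseteq> sets (F s)"
    using measurable_sets[OF Y] by auto
  then have 1: "sigma_sets (space M) {Y -` A \<inter> space M |A. A \<in> sets borel} \<subseteq> sets (F s)"
    using sets.sigma_sets_subset[of _ "F s"] by simp
  have "(\<lambda>\<omega>. \<phi> (?D \<omega>)) \<in> borel_measurable ?V"
    by (rule measurable_compose[OF measurable_vimage_algebra1 \<phi>]) simp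
  from measurable_sets[OF this]
  have "{(\<lambda>\<omega>. \<phi> (?D \<omega>)) -` A \<inter> space M |A. A \<in> sets borel} \<subseteq> sets ?V" by auto
  then have 2: "sigma_sets (space M) {(\<lambda>\<omega>. \<phi> (?D \<omega>)) -` A \<inter> space M |A. A \<in> sets borel} \<subseteq> sets ?V"
    using sets.sigma_sets_subset[of _ ?V] by simp
  show "indep_set (sigma_sets (space M) {Y -` A \<inter> space M |A. A \<in> sets borel})
     (sigma_sets (space M) {(\<lambda>\<omega>. \<phi> (?D \<omega>)) -` A \<inter> space M |A. A \<in> sets borel})"
    using ind 1 2 unfolding indep_sets2_eq by blast
qed

text \<open>Independence of the past splits the expectation, and the increment is centred.
  Independence also yields integrability of the product from mere integrability of
  \<open>Y\<close>.\<close>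

lemma expectation_times_incr:
  fixes Y :: "'w \<Rightarrow> real"
  assumes st: "0 \<le> s" "s \<le> t" and Y: "Y \<in> borel_measurable (F s)" "integrable M Y"
  shows integrable_times_incr: "integrable M (\<lambda>\<omega>. Y \<omega> * incr i s t \<omega>)"
    and "expectation (\<lambda>\<omega>. Y \<omega> * incr i s t \<omega>) = 0"
proof -
  have "integrable M (\<lambda>\<omega>. Y \<omega> * incr i s t \<omega>) \<and> expectation (\<lambda>\<omega>. Y \<omega> * incr i s t \<omega>) = 0"
  proof (cases "s = t")
    case False
    then have ind: "indep_var borel Y borel (incr i s t)"
      using indep_increment[OF st(1) _ Y(1) vec_nth_measurable, of t i] st
      by (simp add: incr_def[abs_def])
    note int = integrable_incr[OF st, of i]
    show ?thesis
      using indep_var_integrable[OF ind Y(2) int] indep_var_lebesgue_integral[OF ind Y(2) int]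
        expectation_incr[OF st, of i] by simp
  qed simp
  then show "integrable M (\<lambda>\<omega>. Y \<omega> * incr i s t \<omega>)"
    and "expectation (\<lambda>\<omega>. Y \<omega> * incr i s t \<omega>) = 0" by auto
qed

lemma expectation_times_incr_incr:
  fixes Y :: "'w \<Rightarrow> real"
  assumes st: "0 \<le> s" "s \<le> t" and Y: "Y \<in> borel_measurable (F s)" "integrable M Y"
  shows "expectation (\<lambda>\<omega>. Y \<omega> * (incr i s t \<omega> * incr j s t \<omega>)) =
    (if i = j then t - s else 0) * expectation Y"
proof (cases "s = t")
  case False
  have "(\<lambda>a :: real^'d. a $ i * a $ j) \<in> borel_measurable borel"
    by (intro borel_measurable_times vec_nth_measurable)
  then have ind: "indep_var borel Y borel (\<lambda>\<omega>. incr i s t \<omega> * incr j s t \<omega>)"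
    using indep_increment[OF st(1) _ Y(1), of t "\<lambda>a. a $ i * a $ j"] st False
    by (simp add: incr_def[abs_def])
  show ?thesis
    using indep_var_lebesgue_integral[OF ind Y(2) integrable_incr_incr[OF st, of i j]]
      expectation_incr_incr[OF st, of i j] by simp
qed simp

lemma sq_integrable_bounded_times_incr:
  fixes X :: "'w \<Rightarrow> real"
  assumes st: "0 \<le> s" "s \<le> t" and X: "X \<in> borel_measurable M"
    and bd: "\<And>\<omega>. \<omega> \<in> space M \<Longrightarrow> \<bar>X \<omega>\<bar> \<le> C"
  shows "sq_integrable M (\<lambda>\<omega>. X \<omega> * incr i s t \<omega>)"
  unfolding sq_integrable_def
proof
  note sq = sq_integrable_incr[OF st, of i]
  show m: "(\<lambda>\<omega>. X \<omega> * incr i s t \<omega>) \<in> borel_measurable M"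
    using X sq_integrable_measurable[OF sq] by (rule borel_measurable_times)
  show "integrable M (\<lambda>\<omega>. (norm (X \<omega> * incr i s t \<omega>))\<^sup>2)"
  proof (rule Bochner_Integration.integrable_bound)
    show "integrable M (\<lambda>\<omega>. C\<^sup>2 * (norm (incr i s t \<omega>))\<^sup>2)"
      using sq_integrable_norm[OF sq] by simp
    show "(\<lambda>\<omega>. (norm (X \<omega> * incr i s t \<omega>))\<^sup>2) \<in> borel_measurable M"
      using m by simp
    have "(X \<omega>)\<^sup>2 \<le> C\<^sup>2" if "\<omega> \<in> space M" for \<omega>
      using power_mono[OF bd[OF that], of 2] by simp
    then show "AE \<omega> in M. norm ((norm (X \<omega> * incr i s t \<omega>))\<^sup>2) \<le> norm (C\<^sup>2 * (norm (incr i s t \<omega>))\<^sup>2)"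
      by (auto simp: power_mult_distrib intro!: AE_I2 mult_right_mono)
  qed
qed

text \<open>The first three factors are known at time \<open>c\<close>; the last increment is
  independent of \<open>F c\<close> and centred.\<close>

lemma expectation_incr_orthogonal:
  fixes X Y :: "'w \<Rightarrow> real"
  assumes ab: "0 \<le> a" "a \<le> b" "b \<le> c" "c \<le> d"
    and X: "X \<in> borel_measurable (F a)" "\<And>\<omega>. \<omega> \<in> space M \<Longrightarrow> \<bar>X \<omega>\<bar> \<le> C"
    and Y: "Y \<in> borel_measurable (F c)" "\<And>\<omega>. \<omega> \<in> space M \<Longrightarrow> \<bar>Y \<omega>\<bar> \<le> C'"
  shows "expectation (\<lambda>\<omega>. (X \<omega> * incr i a b \<omega>) * (Y \<omega> * incr j c d \<omega>)) = 0"
proof -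
  have "(\<lambda>\<omega>. (X \<omega> * incr i a b \<omega>) * Y \<omega>) \<in> borel_measurable (F c)"
    using ab by (intro borel_measurable_times Y F_measurable_mono[OF X(1)]
      F_measurable_mono[OF incr_measurable]) auto
  moreover have "integrable M (\<lambda>\<omega>. (X \<omega> * incr i a b \<omega>) * Y \<omega>)"
    using sq_integrable_inner[OF
      sq_integrable_bounded_times_incr[where i = i, OF ab(1,2) F_measurable[OF X(1)] X(2)]
      sq_integrable_bounded[where C = C', OF F_measurable[OF Y(1)]]] Y(2) by simp
  ultimately have "expectation (\<lambda>\<omega>. ((X \<omega> * incr i a b \<omega>) * Y \<omega>) * incr j c d \<omega>) = 0"
    using ab by (intro expectation_times_incr) auto
  then show ?thesis by (simp add: mult.assoc)
qed

text \<open>The bilinear isometry for one step of each integrand. The two intervals may overlap in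
  any way, so sums over two different partitions can be handled pair by pair. Cutting an interval at
  an endpoint of the other leaves pieces that do not meet, whose contribution vanishes, and one
  common piece, whose length appears.\<close>

lemma expectation_incr_overlap:
  fixes X Y :: "'w \<Rightarrow> real"
  assumes ab: "0 \<le> a" "a \<le> b" and cd: "0 \<le> c" "c \<le> d"
    and X: "X \<in> borel_measurable (F a)" "\<And>\<omega>. \<omega> \<in> space M \<Longrightarrow> \<bar>X \<omega>\<bar> \<le> C"
    and Y: "Y \<in> borel_measurable (F c)" "\<And>\<omega>. \<omega> \<in> space M \<Longrightarrow> \<bar>Y \<omega>\<bar> \<le> C'"
  shows "expectation (\<lambda>\<omega>. (X \<omega> * incr i a b \<omega>) * (Y \<omega> * incr j c d \<omega>)) =
    (if i = j then measure lborel ({a<..b} \<inter> {c<..d}) else 0) * expectation (\<lambda>\<omega>. X \<omega> * Y \<omega>)"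
proof -
  \<comment> \<open>\<open>Q\<close> carries all data as arguments, so that the two factors can be
    swapped and each case below needs one order only.\<close>
  define Q where "Q X i a b Y j c d = expectation (\<lambda>\<omega>. (X \<omega> * incr i a b \<omega>) * (Y \<omega> * incr j c d \<omega>))"
    for X Y :: "'w \<Rightarrow> real" and i j a b c d
  have Q_commute: "Q X i a b Y j c d = Q Y j c d X i a b" for X Y i j a b c d
    by (simp add: Q_def mult.commute)
  have sq: "sq_integrable M (\<lambda>\<omega>. X \<omega> * incr i s t \<omega>)"
    if "0 \<le> s" "s \<le> t" "X \<in> borel_measurable M" "\<And>\<omega>. \<omega> \<in> space M \<Longrightarrow> \<bar>X \<omega>\<bar> \<le> C" for X i s t C
    using that by (rule sq_integrable_bounded_times_incr)
  have Q_split: "Q X i a b Y j c d = Q X i a m Y j c d + Q X i m b Y j c d"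
    if "0 \<le> a" "a \<le> m" "m \<le> b" "0 \<le> c" "c \<le> d" "X \<in> borel_measurable M" "Y \<in> borel_measurable M"
      "\<And>\<omega>. \<omega> \<in> space M \<Longrightarrow> \<bar>X \<omega>\<bar> \<le> C" "\<And>\<omega>. \<omega> \<in> space M \<Longrightarrow> \<bar>Y \<omega>\<bar> \<le> C'"
    for X Y i j a b m c d C C'
  proof -
    have "integrable M (\<lambda>\<omega>. (X \<omega> * incr i a m \<omega>) * (Y \<omega> * incr j c d \<omega>))"
      "integrable M (\<lambda>\<omega>. (X \<omega> * incr i m b \<omega>) * (Y \<omega> * incr j c d \<omega>))"
      using sq_integrable_inner[OF sq[of a m X C i] sq[of c d Y C' j]]
        sq_integrable_inner[OF sq[of m b X C i] sq[of c d Y C' j]] that by auto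
    then have "Q X i a m Y j c d + Q X i m b Y j c d = expectation (\<lambda>\<omega>.
       (X \<omega> * incr i a m \<omega>) * (Y \<omega> * incr j c d \<omega>) + (X \<omega> * incr i m b \<omega>) * (Y \<omega> * incr j c d \<omega>))"
      unfolding Q_def by (rule Bochner_Integration.integral_add[symmetric])
    also have "\<dots> = Q X i a b Y j c d"
      unfolding Q_def by (rule Bochner_Integration.integral_cong)
        (auto simp: incr_add[of i a m _ b, symmetric] algebra_simps)
    finally show ?thesis by simp
  qed
  \<comment> \<open>Common left end, first interval the shorter: the second is cut at
    \<open>b\<close>. Its tail lies after the first interval and contributes nothing; on
    \<open>(c, b]\<close> both coefficients are known at \<open>c\<close> and independent of the
    increments.\<close>
  have same_start_le: "Q X i c b Y j c d = (if i = j then b - c else 0) * expectation (\<lambda>\<omega>. X \<omega> * Y \<omega>)"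
    if "0 \<le> c" "c \<le> b" "b \<le> d" and X: "X \<in> borel_measurable (F c)" "\<And>\<omega>. \<omega> \<in> space M \<Longrightarrow> \<bar>X \<omega>\<bar> \<le> C"
      and Y: "Y \<in> borel_measurable (F c)" "\<And>\<omega>. \<omega> \<in> space M \<Longrightarrow> \<bar>Y \<omega>\<bar> \<le> C'"
    for X Y i j c b d C C'
  proof -
    have "Q Y j c d X i c b = Q Y j c b X i c b + Q Y j b d X i c b"
      by (rule Q_split) (use that X Y in \<open>auto intro: F_measurable\<close>)
    moreover have "Q X i c b Y j b d = 0"
      unfolding Q_def using that
      by (intro expectation_incr_orthogonal[where C = C and C' = C'] X Y F_measurable_mono[OF Y(1)]) auto
    moreover have "Q X i c b Y j c b = (if i = j then b - c else 0) * expectation (\<lambda>\<omega>. X \<omega> * Y \<omega>)"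
    proof -
      have "integrable M (\<lambda>\<omega>. X \<omega> * Y \<omega>)"
        using sq_integrable_inner[OF sq_integrable_bounded[where C = C, OF F_measurable[OF X(1)]]
          sq_integrable_bounded[where C = C', OF F_measurable[OF Y(1)]]] X(2) Y(2) by simp
      then have "expectation (\<lambda>\<omega>. (X \<omega> * Y \<omega>) * (incr i c b \<omega> * incr j c b \<omega>)) =
        (if i = j then b - c else 0) * expectation (\<lambda>\<omega>. X \<omega> * Y \<omega>)"
        using that X(1) Y(1) by (intro expectation_times_incr_incr borel_measurable_times) auto
      then show ?thesis by (simp add: Q_def mult_ac)
    qed
    ultimately show ?thesis by (simp add: Q_commute)
  qed
  have start_le: "Q X i a b Y j c d =
      (if i = j then measure lborel ({a<..b} \<inter> {c<..d}) else 0) * expectation (\<lambda>\<omega>. X \<omega> * Y \<omega>)"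
    if "0 \<le> a" "a \<le> c" "a \<le> b" "c \<le> d" and X: "X \<in> borel_measurable (F a)" "\<And>\<omega>. \<omega> \<in> space M \<Longrightarrow> \<bar>X \<omega>\<bar> \<le> C"
      and Y: "Y \<in> borel_measurable (F c)" "\<And>\<omega>. \<omega> \<in> space M \<Longrightarrow> \<bar>Y \<omega>\<bar> \<le> C'"
    for X Y i j a b c d C C'
  proof (cases "b \<le> c")
    case True
    then have "{a<..b} \<inter> {c<..d} = {}" by auto
    moreover have "Q X i a b Y j c d = 0"
      unfolding Q_def using that True
      by (intro expectation_incr_orthogonal[where C = C and C' = C'] X Y) auto
    ultimately show ?thesis by (simp only: measure_empty if_cancel mult_zero_left)
  next
    case False
    \<comment> \<open>Once the part of the first interval before \<open>c\<close> is split off, the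
      rest starts at \<open>c\<close> too; there \<open>X\<close> has to be known at time
      \<open>c\<close>.\<close>
    have Xc: "X \<in> borel_measurable (F c)" using X(1) \<open>a \<le> c\<close> by (rule F_measurable_mono)
    have "Q X i a b Y j c d = Q X i a c Y j c d + Q X i c b Y j c d"
      by (rule Q_split) (use that X Y False in \<open>auto intro: F_measurable\<close>)
    moreover have "Q X i a c Y j c d = 0"
      unfolding Q_def using that
      by (intro expectation_incr_orthogonal[where C = C and C' = C'] X Y) auto
    \<comment> \<open>The interval that ends first takes the role of the shorter one, by symmetry if
      it is the second.\<close>
    moreover have "Q X i c b Y j c d = (if i = j then min b d - c else 0) * expectation (\<lambda>\<omega>. X \<omega> * Y \<omega>)"
    proof (cases "b \<le> d")
      case True
      then show ?thesis
        using same_start_le[of c b d X C Y C' i j] that False Xc by (simp add: min_def)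
    next
      case d: False
      then show ?thesis
        using same_start_le[of c d b Y C' X C j i] that False Xc
        by (simp add: min_def Q_commute[of X] mult.commute)
    qed
    moreover have "{a<..b} \<inter> {c<..d} = {c<..min b d}" using \<open>a \<le> c\<close> by auto
    ultimately show ?thesis using False that by simp
  qed
  show ?thesis
  proof (cases "a \<le> c")
    case True
    show ?thesis
      using start_le[OF ab(1) True ab(2) cd(2) X Y] unfolding Q_def .
  next
    case False
    then show ?thesis
      using start_le[OF cd(1) _ cd(2) ab(2) Y X, of j i]
      unfolding Q_commute[of Y] unfolding Q_def by (simp add: Int_commute mult.commute)
  qed
qed

end

section \<open>Ito integrals\<close>

text \<open>Tonelli, with the time integral inside. It identifies the norm that
  \<open>M2_process\<close> and \<open>has_ito_integral\<close> use with the L2 norm over the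
  product measure.\<close>

lemma nn_integral_time_product:
  fixes f :: "real \<Rightarrow> 'w \<Rightarrow> ennreal"
  assumes "sigma_finite_measure M"
    and f: "(\<lambda>(t, \<omega>). f t \<omega>) \<in> borel_measurable (restrict_space borel {0..T} \<Otimes>\<^sub>M M)"
  shows "(\<integral>\<^sup>+\<omega>. (\<integral>\<^sup>+t\<in>{0..T}. f t \<omega> \<partial>lborel) \<partial>M) =
    (\<integral>\<^sup>+(t, \<omega>). f t \<omega> \<partial>(restrict_space lborel {0..T} \<Otimes>\<^sub>M M))"
proof -
  interpret T: sigma_finite_measure "restrict_space lborel {0..T}"
    by (intro sigma_finite_measure_restrict_space sigma_finite_lborel) simp
  interpret M: sigma_finite_measure M by fact
  interpret pair_sigma_finite "restrict_space lborel {0..T}" M ..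
  have "sets (restrict_space borel {0..T} \<Otimes>\<^sub>M M) = sets (restrict_space lborel {0..T} \<Otimes>\<^sub>M M)"
    by (intro sets_pair_measure_cong) (simp_all add: sets_restrict_space)
  then have "(\<lambda>(t, \<omega>). f t \<omega>) \<in> borel_measurable (restrict_space lborel {0..T} \<Otimes>\<^sub>M M)"
    using f by (simp cong: measurable_cong_sets)
  from nn_integral_snd[OF this] show ?thesis
    by (simp add: nn_integral_restrict_space)
qed

text \<open>Adaptedness is stated over \<open>borel\<close> while integration needs
  \<open>lborel\<close>; this passes between the two.\<close>

lemma sets_time_product:
  "sets (restrict_space lborel A \<Otimes>\<^sub>M M) = sets (restrict_space borel A \<Otimes>\<^sub>M M)"
  by (intro sets_pair_measure_cong) (simp_all add: sets_restrict_space)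

lemma finite_measure_time: "finite_measure (restrict_space lborel {0..T::real})"
  by (rule finite_measureI) (simp add: emeasure_restrict_space space_restrict_space emeasure_lborel_Icc_eq)

lemma integral_double_sum:
  fixes Q :: "nat \<Rightarrow> nat \<Rightarrow> 'a \<Rightarrow> real"
  assumes "\<And>i j. i < n \<Longrightarrow> j < n' \<Longrightarrow> integrable K (Q i j) \<and> integral\<^sup>L K (Q i j) = e i j"
  shows "(\<integral>s. (\<Sum>i<n. \<Sum>j<n'. Q i j s) \<partial>K) = (\<Sum>i<n. \<Sum>j<n'. e i j)"
proof -
  have inner: "integrable K (\<lambda>s. \<Sum>j<n'. Q i j s) \<and>
      (\<integral>s. (\<Sum>j<n'. Q i j s) \<partial>K) = (\<Sum>j<n'. e i j)" if "i < n" for i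
    using assms[OF that] by (auto simp: Bochner_Integration.integral_sum)
  then show ?thesis
    by (subst Bochner_Integration.integral_sum) auto
qed

lemma inner_sum_sum:
  "(\<Sum>i\<in>A. X i) \<bullet> (\<Sum>j\<in>B. Y j) = (\<Sum>i\<in>A. \<Sum>j\<in>B. X i \<bullet> Y j)"
  by (subst inner_sum_left) (simp only: inner_sum_right)

section \<open>Ito integrals of simple integrands\<close>

context brownian_space
begin

lemma sq_integrable_bounded_mult_incr:
  fixes A :: "'w \<Rightarrow> real^'d^'m"
  assumes st: "0 \<le> s" "s \<le> t" and A: "A \<in> borel_measurable M"
    and bd: "\<And>\<omega>. \<omega> \<in> space M \<Longrightarrow> norm (A \<omega>) \<le> C"
  shows "sq_integrable M (\<lambda>\<omega>. A \<omega> *v (W t \<omega> - W s \<omega>))"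
proof (rule sq_integrable_vecI)
  fix r
  have "(\<lambda>\<omega>. A \<omega> $ r $ i) \<in> borel_measurable M" for i
    by (rule measurable_compose[OF measurable_compose[OF A vec_nth_measurable] vec_nth_measurable])
  moreover have "\<bar>A \<omega> $ r $ i\<bar> \<le> C" if "\<omega> \<in> space M" for \<omega> i
    using Finite_Cartesian_Product.norm_nth_le[of "A \<omega> $ r" i]
      Finite_Cartesian_Product.norm_nth_le[of "A \<omega>" r] bd[OF that] by simp
  ultimately have "sq_integrable M (\<lambda>\<omega>. A \<omega> $ r $ i * incr i s t \<omega>)" for i
    using st by (intro sq_integrable_bounded_times_incr) auto
  then have "sq_integrable M (\<lambda>\<omega>. \<Sum>i\<in>UNIV. A \<omega> $ r $ i * incr i s t \<omega>)"
    by (intro sq_integrable_sum)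
  then show "sq_integrable M (\<lambda>\<omega>. (A \<omega> *v (W t \<omega> - W s \<omega>)) $ r)"
    by (simp add: matrix_vector_mult_def incr_def)
qed

text \<open>Coordinatewise expansion with one row index and two Brownian indices. Different Brownian
  coordinates are uncorrelated, so the double sum over them collapses to its diagonal and leaves the
  entrywise inner product of the matrices.\<close>

lemma expectation_mult_incr_overlap:
  fixes A B :: "'w \<Rightarrow> real^'d^'m"
  assumes ab: "0 \<le> a" "a \<le> b" and cd: "0 \<le> c" "c \<le> d"
    and A: "A \<in> borel_measurable (F a)" "\<And>\<omega>. \<omega> \<in> space M \<Longrightarrow> norm (A \<omega>) \<le> C"
    and B: "B \<in> borel_measurable (F c)" "\<And>\<omega>. \<omega> \<in> space M \<Longrightarrow> norm (B \<omega>) \<le> C'"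
  shows "expectation (\<lambda>\<omega>. (A \<omega> *v (W b \<omega> - W a \<omega>)) \<bullet> (B \<omega> *v (W d \<omega> - W c \<omega>))) =
    measure lborel ({a<..b} \<inter> {c<..d}) * expectation (\<lambda>\<omega>. A \<omega> \<bullet> B \<omega>)"
proof -
  have Am: "(\<lambda>\<omega>. A \<omega> $ r $ i) \<in> borel_measurable (F a)"
    and Bm: "(\<lambda>\<omega>. B \<omega> $ r $ i) \<in> borel_measurable (F c)" for r i
    by (rule measurable_compose[OF measurable_compose[OF A(1) vec_nth_measurable] vec_nth_measurable])
       (rule measurable_compose[OF measurable_compose[OF B(1) vec_nth_measurable] vec_nth_measurable])
  have Abd: "\<bar>A \<omega> $ r $ i\<bar> \<le> C" and Bbd: "\<bar>B \<omega> $ r $ i\<bar> \<le> C'" if "\<omega> \<in> space M" for \<omega> r i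
    using Finite_Cartesian_Product.norm_nth_le[of "A \<omega> $ r" i]
      Finite_Cartesian_Product.norm_nth_le[of "A \<omega>" r] A(2)[OF that]
      Finite_Cartesian_Product.norm_nth_le[of "B \<omega> $ r" i]
      Finite_Cartesian_Product.norm_nth_le[of "B \<omega>" r] B(2)[OF that] by simp_all
  have sqA: "sq_integrable M (\<lambda>\<omega>. A \<omega> $ r $ i * incr i a b \<omega>)"
    and sqB: "sq_integrable M (\<lambda>\<omega>. B \<omega> $ r $ i * incr i c d \<omega>)" for r i
    using ab cd by (auto intro!: sq_integrable_bounded_times_incr F_measurable[OF Am] F_measurable[OF Bm] Abd Bbd)
  have int: "integrable M (\<lambda>\<omega>. (A \<omega> $ r $ i * incr i a b \<omega>) * (B \<omega> $ r $ j * incr j c d \<omega>))" for r i j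
    using sq_integrable_inner[OF sqA sqB] by simp
  have int': "integrable M (\<lambda>\<omega>. A \<omega> $ r $ i * B \<omega> $ r $ i)" for r i
    using sq_integrable_inner[OF sq_integrable_bounded[where C = C, OF F_measurable[OF Am]]
      sq_integrable_bounded[where C = C', OF F_measurable[OF Bm]]] Abd Bbd by simp
  let ?vol = "measure lborel ({a<..b} \<inter> {c<..d})"
  have "expectation (\<lambda>\<omega>. (A \<omega> *v (W b \<omega> - W a \<omega>)) \<bullet> (B \<omega> *v (W d \<omega> - W c \<omega>))) =
    expectation (\<lambda>\<omega>. \<Sum>r\<in>UNIV. \<Sum>i\<in>UNIV. \<Sum>j\<in>UNIV.
      (A \<omega> $ r $ i * incr i a b \<omega>) * (B \<omega> $ r $ j * incr j c d \<omega>))"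
    by (simp add: inner_vec_def matrix_vector_mult_def incr_def[symmetric] sum_product
        del: vector_minus_component)
  also have "\<dots> = (\<Sum>r\<in>UNIV. \<Sum>i\<in>UNIV. \<Sum>j\<in>UNIV.
      expectation (\<lambda>\<omega>. (A \<omega> $ r $ i * incr i a b \<omega>) * (B \<omega> $ r $ j * incr j c d \<omega>)))"
    by (simp add: int)
  also have "\<dots> = (\<Sum>r\<in>UNIV. \<Sum>i\<in>UNIV. \<Sum>j\<in>UNIV.
      (if i = j then ?vol else 0) * expectation (\<lambda>\<omega>. A \<omega> $ r $ i * B \<omega> $ r $ j))"
    by (intro sum.cong refl expectation_incr_overlap[OF ab cd Am Abd Bm Bbd])
  also have "\<dots> = ?vol * (\<Sum>r\<in>UNIV. \<Sum>i\<in>UNIV. expectation (\<lambda>\<omega>. A \<omega> $ r $ i * B \<omega> $ r $ i))"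
    by (simp add: if_distrib[of "\<lambda>x. x * _"] sum_distrib_left cong: if_cong)
  also have "(\<Sum>r\<in>UNIV. \<Sum>i\<in>UNIV. expectation (\<lambda>\<omega>. A \<omega> $ r $ i * B \<omega> $ r $ i)) =
      expectation (\<lambda>\<omega>. A \<omega> \<bullet> B \<omega>)"
    by (simp add: inner_vec_def int')
  finally show ?thesis .
qed

lemma simple_integrandD:
  assumes "simple_integrand F T N \<tau> \<zeta>" "i < N"
  shows "0 \<le> \<tau> i" "\<tau> i \<le> \<tau> (Suc i)" "\<tau> (Suc i) \<le> T" "\<zeta> i \<in> borel_measurable (F (\<tau> i))"
    "\<exists>C. \<forall>\<omega>\<in>space M. norm (\<zeta> i \<omega>) \<le> C"
  using assms by (auto simp: simple_integrand_def)

lemma sq_integrable_simple_ito: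
  assumes \<zeta>: "simple_integrand F T N \<tau> \<zeta>" and "0 \<le> t"
  shows "sq_integrable M (simple_ito_integral W N \<tau> \<zeta> t)"
  unfolding simple_ito_integral_def[abs_def]
proof (rule sq_integrable_sum)
  fix i assume "i \<in> {..<N}"
  then have i: "i < N" by simp
  note D = simple_integrandD[OF \<zeta> i]
  from D(5) obtain C where "\<And>\<omega>. \<omega> \<in> space M \<Longrightarrow> norm (\<zeta> i \<omega>) \<le> C" by auto
  then show "sq_integrable M (\<lambda>\<omega>. \<zeta> i \<omega> *v (W (min (\<tau> (Suc i)) t) \<omega> - W (min (\<tau> i) t) \<omega>))"
    using D \<open>0 \<le> t\<close> by (intro sq_integrable_bounded_mult_incr F_measurable[OF D(4)]) auto
qed

text \<open>All nodes lie in \<open>{0..T}\<close>, so truncation at \<open>T\<close> has no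
  effect.\<close>

lemma simple_ito_terminal:
  assumes "simple_integrand F T N \<tau> \<zeta>"
  shows "simple_ito_integral W N \<tau> \<zeta> T \<omega> = (\<Sum>i<N. \<zeta> i \<omega> *v (W (\<tau> (Suc i)) \<omega> - W (\<tau> i) \<omega>))"
  unfolding simple_ito_integral_def
proof (rule sum.cong[OF refl])
  fix i assume "i \<in> {..<N}"
  with assms simple_integrandD[OF assms, of i]
  have "min (\<tau> (Suc i)) T = \<tau> (Suc i)" "min (\<tau> i) T = \<tau> i" by auto
  then show "\<zeta> i \<omega> *v (W (min (\<tau> (Suc i)) T) \<omega> - W (min (\<tau> i) T) \<omega>) =
    \<zeta> i \<omega> *v (W (\<tau> (Suc i)) \<omega> - W (\<tau> i) \<omega>)" by simp
qed

text \<open>The martingale property, tested against each \<open>Y\<close> known at time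
  \<open>s\<close>. Between \<open>s\<close> and \<open>T\<close> a simple integral is again a sum
  of coefficients times increments, each starting no earlier than \<open>s\<close>.\<close>

lemma simple_ito_martingale:
  fixes \<zeta> :: "nat \<Rightarrow> 'w \<Rightarrow> real^'d^'m"
  assumes \<zeta>: "simple_integrand F T N \<tau> \<zeta>" and s: "0 \<le> s" "s \<le> T"
    and Y: "Y \<in> borel_measurable (F s)" "sq_integrable M Y"
  shows "expectation (\<lambda>\<omega>. Y \<omega> \<bullet> simple_ito_integral W N \<tau> \<zeta> T \<omega>) =
    expectation (\<lambda>\<omega>. Y \<omega> \<bullet> simple_ito_integral W N \<tau> \<zeta> s \<omega>)"
proof -
  \<comment> \<open>Taking \<open>max\<close> with \<open>s\<close> discards what happens before
    \<open>s\<close>: a step that ends before \<open>s\<close> becomes empty, a step across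
    \<open>s\<close> is shortened.\<close>
  have 0: "integrable M (\<lambda>\<omega>. Y \<omega> \<bullet> (\<zeta> i \<omega> *v (W (max (\<tau> (Suc i)) s) \<omega> - W (max (\<tau> i) s) \<omega>))) \<and>
      expectation (\<lambda>\<omega>. Y \<omega> \<bullet> (\<zeta> i \<omega> *v (W (max (\<tau> (Suc i)) s) \<omega> - W (max (\<tau> i) s) \<omega>))) = 0"
    if i: "i < N" for i
  proof -
    note D = simple_integrandD[OF \<zeta> i]
    from D(5) obtain C where C: "\<And>\<omega>. \<omega> \<in> space M \<Longrightarrow> norm (\<zeta> i \<omega>) \<le> C" by auto
    \<comment> \<open>At time \<open>a\<close> both \<open>Y\<close> and \<open>\<zeta> i\<close>
      are known.\<close>
    define a where "a = max (\<tau> i) s"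
    define b where "b = max (\<tau> (Suc i)) s"
    have ab: "0 \<le> a" "a \<le> b" using D s by (auto simp: a_def b_def)
    have Ym: "(\<lambda>\<omega>. Y \<omega> $ r) \<in> borel_measurable (F s)" for r
      by (rule measurable_compose[OF Y(1) vec_nth_measurable])
    have \<zeta>m: "(\<lambda>\<omega>. \<zeta> i \<omega> $ r $ q) \<in> borel_measurable (F (\<tau> i))" for r q
      by (rule measurable_compose[OF measurable_compose[OF D(4) vec_nth_measurable] vec_nth_measurable])
    have bd: "\<bar>\<zeta> i \<omega> $ r $ q\<bar> \<le> C" if "\<omega> \<in> space M" for \<omega> r q
      using Finite_Cartesian_Product.norm_nth_le[of "\<zeta> i \<omega> $ r" q]
        Finite_Cartesian_Product.norm_nth_le[of "\<zeta> i \<omega>" r] C[OF that] by simp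
    have m: "(\<lambda>\<omega>. Y \<omega> $ r * \<zeta> i \<omega> $ r $ q) \<in> borel_measurable (F a)" for r q
      by (intro borel_measurable_times F_measurable_mono[OF Ym] F_measurable_mono[OF \<zeta>m])
         (auto simp: a_def)
    have int: "integrable M (\<lambda>\<omega>. Y \<omega> $ r * \<zeta> i \<omega> $ r $ q)" for r q
      using sq_integrable_inner[OF sq_integrable_nth[OF Y(2)]
        sq_integrable_bounded[where C = C, OF F_measurable[OF \<zeta>m]]] bd by simp
    have eq: "Y \<omega> \<bullet> (\<zeta> i \<omega> *v (W b \<omega> - W a \<omega>)) =
      (\<Sum>r\<in>UNIV. \<Sum>q\<in>UNIV. (Y \<omega> $ r * \<zeta> i \<omega> $ r $ q) * incr q a b \<omega>)" for \<omega>
      by (simp add: inner_vec_def matrix_vector_mult_def incr_def[symmetric] sum_distrib_left mult.assoc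
        del: vector_minus_component)
    show ?thesis
      unfolding a_def[symmetric] b_def[symmetric] eq
      using integrable_times_incr[OF ab m int] expectation_times_incr(2)[OF ab m int] by simp
  qed
  \<comment> \<open>For a node \<open>r\<close> in \<open>{0..T}\<close>,
    \<open>W (min r T) - W (min r s)\<close> equals \<open>W (max r s) - W s\<close>; the term
    \<open>W s\<close> cancels between neighbouring nodes.\<close>
  have "simple_ito_integral W N \<tau> \<zeta> T \<omega> - simple_ito_integral W N \<tau> \<zeta> s \<omega> =
    (\<Sum>i<N. \<zeta> i \<omega> *v (W (max (\<tau> (Suc i)) s) \<omega> - W (max (\<tau> i) s) \<omega>))" for \<omega>
    unfolding simple_ito_integral_def sum_subtractf[symmetric]
      matrix_vector_mult_diff_distrib[symmetric]
  proof (intro sum.cong refl arg_cong2[where f = matrix_vector_mult])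
    fix i assume "i \<in> {..<N}"
    then have "i < N" by simp
    note D = simple_integrandD[OF \<zeta> this]
    then show "W (min (\<tau> (Suc i)) T) \<omega> - W (min (\<tau> i) T) \<omega> - (W (min (\<tau> (Suc i)) s) \<omega> - W (min (\<tau> i) s) \<omega>)
      = W (max (\<tau> (Suc i)) s) \<omega> - W (max (\<tau> i) s) \<omega>"
      using s by (auto simp: min_def max_def)
  qed
  then have "expectation (\<lambda>\<omega>. Y \<omega> \<bullet> (simple_ito_integral W N \<tau> \<zeta> T \<omega> - simple_ito_integral W N \<tau> \<zeta> s \<omega>)) = 0"
    using 0 by (simp add: inner_sum_right)
  moreover have "integrable M (\<lambda>\<omega>. Y \<omega> \<bullet> simple_ito_integral W N \<tau> \<zeta> t \<omega>)" if "0 \<le> t" for t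
    using sq_integrable_inner[OF Y(2) sq_integrable_simple_ito[OF \<zeta> that]] .
  ultimately show ?thesis using s by (simp add: inner_diff_right)
qed

lemma measurable_simple_process:
  assumes \<zeta>: "simple_integrand F T N \<tau> \<zeta>"
  shows "(\<lambda>(t, \<omega>). simple_process N \<tau> \<zeta> t \<omega>) \<in> borel_measurable (restrict_space lborel {0..T} \<Otimes>\<^sub>M M)"
proof -
  have [measurable]: "(\<lambda>\<omega>. \<zeta> i \<omega>) \<in> borel_measurable M" if "i < N" for i
    using F_measurable[OF simple_integrandD(4)[OF \<zeta> that]] .
  have [measurable]: "(\<lambda>t. indicator {a<..b} t :: real) \<in> borel_measurable (restrict_space lborel {0..T})" for a b
    by (rule measurable_restrict_space1) simp
  show ?thesis
    unfolding simple_process_def split_def by measurable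
qed

lemma simple_process_term_sq_integrable:
  assumes \<zeta>: "simple_integrand F T N \<tau> \<zeta>" and i: "i < N"
  shows "sq_integrable (restrict_space lborel {0..T} \<Otimes>\<^sub>M M)
    (\<lambda>(t, \<omega>). indicator {\<tau> i<..\<tau> (Suc i)} t *\<^sub>R \<zeta> i \<omega>)"
proof -
  interpret T: finite_measure "restrict_space lborel {0..T}" by (rule finite_measure_time)
  interpret TM: finite_measure "restrict_space lborel {0..T} \<Otimes>\<^sub>M M"
    by (rule finite_measure_pair_measure) unfold_locales
  have [measurable]: "\<zeta> i \<in> borel_measurable M"
    using F_measurable[OF simple_integrandD(4)[OF \<zeta> i]] .
  have [measurable]: "(\<lambda>t. indicator {a<..b} t :: real) \<in> borel_measurable (restrict_space lborel {0..T})" for a b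
    by (rule measurable_restrict_space1) simp
  from simple_integrandD(5)[OF \<zeta> i] obtain C where C: "\<And>\<omega>. \<omega> \<in> space M \<Longrightarrow> norm (\<zeta> i \<omega>) \<le> C" by auto
  then have "0 \<le> C" using not_empty order_trans[OF norm_ge_zero] by blast
  show ?thesis
  proof (rule TM.sq_integrable_bounded)
    show "norm (case s of (t, \<omega>) \<Rightarrow> indicator {\<tau> i<..\<tau> (Suc i)} t *\<^sub>R \<zeta> i \<omega>) \<le> C"
      if "s \<in> space (restrict_space lborel {0..T} \<Otimes>\<^sub>M M)" for s
      using that C[of "snd s"] \<open>0 \<le> C\<close>
      by (auto simp: space_pair_measure indicator_def)
  qed measurable
qed

lemma simple_process_sq_integrable:
  assumes \<zeta>: "simple_integrand F T N \<tau> \<zeta>"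
  shows "sq_integrable (restrict_space lborel {0..T} \<Otimes>\<^sub>M M) (\<lambda>(t, \<omega>). simple_process N \<tau> \<zeta> t \<omega>)"
  using sq_integrable_sum[OF simple_process_term_sq_integrable[OF \<zeta>], of "{..<N}"]
  by (simp add: simple_process_def split_def)

text \<open>Both sides expand into the same double sum over pairs of steps: the length of the
  overlap times the expectation of the product of the coefficients. Brownian increments give it on
  one side, time integration of the indicators on the other.\<close>

lemma simple_ito_isometry:
  fixes \<zeta> \<zeta>' :: "nat \<Rightarrow> 'w \<Rightarrow> real^'d^'m"
  assumes \<zeta>: "simple_integrand F T N \<tau> \<zeta>" and \<zeta>': "simple_integrand F T N' \<tau>' \<zeta>'"
  shows "expectation (\<lambda>\<omega>. simple_ito_integral W N \<tau> \<zeta> T \<omega> \<bullet> simple_ito_integral W N' \<tau>' \<zeta>' T \<omega>) =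
    (\<integral>s. case_prod (simple_process N \<tau> \<zeta>) s \<bullet> case_prod (simple_process N' \<tau>' \<zeta>') s
      \<partial>(restrict_space lborel {0..T} \<Otimes>\<^sub>M M))"
proof -
  interpret T: finite_measure "restrict_space lborel {0..T}" by (rule finite_measure_time)
  interpret pair_sigma_finite "restrict_space lborel {0..T}" M ..
  let ?TM = "restrict_space lborel {0..T} \<Otimes>\<^sub>M M"
  let ?I = "\<lambda>i. {\<tau> i<..\<tau> (Suc i)}" and ?I' = "\<lambda>j. {\<tau>' j<..\<tau>' (Suc j)}"
  let ?D = "\<lambda>i \<omega>. \<zeta> i \<omega> *v (W (\<tau> (Suc i)) \<omega> - W (\<tau> i) \<omega>)"
  let ?D' = "\<lambda>j \<omega>. \<zeta>' j \<omega> *v (W (\<tau>' (Suc j)) \<omega> - W (\<tau>' j) \<omega>)"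
  let ?E = "\<lambda>i j. measure lborel (?I i \<inter> ?I' j) * expectation (\<lambda>\<omega>. \<zeta> i \<omega> \<bullet> \<zeta>' j \<omega>)"
  let ?P = "\<lambda>i j (t, \<omega>). (indicator (?I i) t *\<^sub>R \<zeta> i \<omega>) \<bullet> (indicator (?I' j) t *\<^sub>R \<zeta>' j \<omega>)"
  have A: "integrable M (\<lambda>\<omega>. ?D i \<omega> \<bullet> ?D' j \<omega>) \<and> expectation (\<lambda>\<omega>. ?D i \<omega> \<bullet> ?D' j \<omega>) = ?E i j"
    if i: "i < N" and j: "j < N'" for i j
  proof -
    note D = simple_integrandD[OF \<zeta> i] and D' = simple_integrandD[OF \<zeta>' j]
    from D(5) D'(5) obtain C C' where C: "\<And>\<omega>. \<omega> \<in> space M \<Longrightarrow> norm (\<zeta> i \<omega>) \<le> C"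
      and C': "\<And>\<omega>. \<omega> \<in> space M \<Longrightarrow> norm (\<zeta>' j \<omega>) \<le> C'" by auto
    show ?thesis
      using expectation_mult_incr_overlap[OF D(1,2) D'(1,2) D(4) C D'(4) C']
        sq_integrable_inner[OF sq_integrable_bounded_mult_incr[OF D(1,2) F_measurable[OF D(4)] C]
          sq_integrable_bounded_mult_incr[OF D'(1,2) F_measurable[OF D'(4)] C']] by simp
  qed
  have B: "integrable ?TM (?P i j) \<and> integral\<^sup>L ?TM (?P i j) = ?E i j"
    if i: "i < N" and j: "j < N'" for i j
  proof
    note D = simple_integrandD[OF \<zeta> i] and D' = simple_integrandD[OF \<zeta>' j]
    show int: "integrable ?TM (?P i j)"
      using sq_integrable_inner[OF simple_process_term_sq_integrable[OF \<zeta> i]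
        simple_process_term_sq_integrable[OF \<zeta>' j]] by (simp add: split_def)
    have "integral\<^sup>L ?TM (?P i j) = (\<integral>t. (\<integral>\<omega>. ?P i j (t, \<omega>) \<partial>M) \<partial>restrict_space lborel {0..T})"
      by (rule integral_fst'[OF int, symmetric])
    also have "\<dots> = (\<integral>t. indicator (?I i \<inter> ?I' j) t * expectation (\<lambda>\<omega>. \<zeta> i \<omega> \<bullet> \<zeta>' j \<omega>) \<partial>restrict_space lborel {0..T})"
      by (intro Bochner_Integration.integral_cong refl) (auto simp: indicator_def)
    also have "\<dots> = (\<integral>t. indicator {0..T} t *\<^sub>R (indicator (?I i \<inter> ?I' j) t * expectation (\<lambda>\<omega>. \<zeta> i \<omega> \<bullet> \<zeta>' j \<omega>)) \<partial>lborel)"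
      by (subst integral_restrict_space) simp_all
    also have "\<dots> = (\<integral>t. indicator (?I i \<inter> ?I' j) t * expectation (\<lambda>\<omega>. \<zeta> i \<omega> \<bullet> \<zeta>' j \<omega>) \<partial>lborel)"
      using D(1,2,3) by (intro Bochner_Integration.integral_cong refl) (auto simp: indicator_def)
    also have "\<dots> = ?E i j"
      by simp
    finally show "integral\<^sup>L ?TM (?P i j) = ?E i j" .
  qed
  have "expectation (\<lambda>\<omega>. simple_ito_integral W N \<tau> \<zeta> T \<omega> \<bullet> simple_ito_integral W N' \<tau>' \<zeta>' T \<omega>) =
      expectation (\<lambda>\<omega>. \<Sum>i<N. \<Sum>j<N'. ?D i \<omega> \<bullet> ?D' j \<omega>)"
    unfolding simple_ito_terminal[OF \<zeta>] simple_ito_terminal[OF \<zeta>']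
    by (simp only: inner_sum_sum)
  also have "\<dots> = (\<Sum>i<N. \<Sum>j<N'. ?E i j)"
    using A by (rule integral_double_sum)
  also have "\<dots> = (\<integral>s. (\<Sum>i<N. \<Sum>j<N'. ?P i j s) \<partial>?TM)"
    using B by (rule integral_double_sum[symmetric])
  also have "\<dots> =
      (\<integral>s. case_prod (simple_process N \<tau> \<zeta>) s \<bullet> case_prod (simple_process N' \<tau>' \<zeta>') s \<partial>?TM)"
    by (intro Bochner_Integration.integral_cong refl)
      (simp only: simple_process_def inner_sum_sum split_def)
  finally show ?thesis .
qed

section \<open>Ito integrals as L2 limits\<close>

lemma measurable_adapted_process:
  assumes "adapted_process M F T X"
  shows "(\<lambda>(t, \<omega>). X t \<omega>) \<in> borel_measurable (restrict_space lborel {0..T} \<Otimes>\<^sub>M M)"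
  using assms unfolding adapted_process_def
  by (simp cong: measurable_cong_sets add: sets_time_product)

lemma M2_process_sq_integrable:
  assumes Z: "M2_process M F T Z"
  shows "sq_integrable (restrict_space lborel {0..T} \<Otimes>\<^sub>M M) (\<lambda>(t, \<omega>). Z t \<omega>)"
proof (rule sq_integrableI)
  from Z have ad: "adapted_process M F T Z"
    and fin: "(\<integral>\<^sup>+\<omega>. (\<integral>\<^sup>+t\<in>{0..T}. ennreal ((norm (Z t \<omega>))\<^sup>2) \<partial>lborel) \<partial>M) < \<infinity>"
    by (auto simp: M2_process_def)
  show m: "(\<lambda>(t, \<omega>). Z t \<omega>) \<in> borel_measurable (restrict_space lborel {0..T} \<Otimes>\<^sub>M M)"
    using ad by (rule measurable_adapted_process)
  have [measurable]: "case_prod Z \<in> borel_measurable (restrict_space borel {0..T} \<Otimes>\<^sub>M M)"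
    using ad by (simp add: adapted_process_def)
  have "(\<lambda>s. ennreal ((norm (case_prod Z s))\<^sup>2)) \<in> borel_measurable (restrict_space borel {0..T} \<Otimes>\<^sub>M M)"
    by measurable
  from nn_integral_time_product[of M "\<lambda>t \<omega>. ennreal ((norm (Z t \<omega>))\<^sup>2)" T] this fin
  show "(\<integral>\<^sup>+ s. ennreal ((norm (case_prod Z s))\<^sup>2) \<partial>(restrict_space lborel {0..T} \<Otimes>\<^sub>M M)) < \<infinity>"
    by (simp add: split_def sigma_finite_measure_axioms)
qed

text \<open>The definition unpacked, with convergence of the integrands rewritten over the product
  measure as \<open>sq_integrable_inner_tendsto\<close> requires.\<close>

lemma has_ito_integral_approx:
  assumes I: "has_ito_integral M F W T Z I"
  obtains N \<tau> \<zeta> where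
    "\<And>j. simple_integrand F T (N j) (\<tau> j) (\<zeta> j)"
    "(\<lambda>j. \<integral>\<^sup>+s. ennreal ((norm (case_prod Z s - case_prod (simple_process (N j) (\<tau> j) (\<zeta> j)) s))\<^sup>2)
       \<partial>(restrict_space lborel {0..T} \<Otimes>\<^sub>M M)) \<longlonglongrightarrow> 0"
    "\<And>t. t \<in> {0..T} \<Longrightarrow> (\<lambda>j. \<integral>\<^sup>+\<omega>.
       ennreal ((norm (I t \<omega> - simple_ito_integral W (N j) (\<tau> j) (\<zeta> j) t \<omega>))\<^sup>2) \<partial>M) \<longlonglongrightarrow> 0"
proof -
  from I obtain N \<tau> \<zeta> where *: "\<And>j. simple_integrand F T (N j) (\<tau> j) (\<zeta> j)"
    and Z: "(\<lambda>j. \<integral>\<^sup>+\<omega>. (\<integral>\<^sup>+t\<in>{0..T}.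
             ennreal ((norm (Z t \<omega> - simple_process (N j) (\<tau> j) (\<zeta> j) t \<omega>))\<^sup>2) \<partial>lborel) \<partial>M)
           \<longlonglongrightarrow> 0"
    and It: "\<And>t. t \<in> {0..T} \<Longrightarrow> (\<lambda>j. \<integral>\<^sup>+\<omega>.
       ennreal ((norm (I t \<omega> - simple_ito_integral W (N j) (\<tau> j) (\<zeta> j) t \<omega>))\<^sup>2) \<partial>M) \<longlonglongrightarrow> 0"
    unfolding has_ito_integral_def by blast
  have "(\<integral>\<^sup>+\<omega>. (\<integral>\<^sup>+t\<in>{0..T}.
      ennreal ((norm (Z t \<omega> - simple_process (N j) (\<tau> j) (\<zeta> j) t \<omega>))\<^sup>2) \<partial>lborel) \<partial>M) =
    (\<integral>\<^sup>+s. ennreal ((norm (case_prod Z s - case_prod (simple_process (N j) (\<tau> j) (\<zeta> j)) s))\<^sup>2)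
       \<partial>(restrict_space lborel {0..T} \<Otimes>\<^sub>M M))" for j
  proof -
    have [measurable]: "case_prod Z \<in> borel_measurable (restrict_space borel {0..T} \<Otimes>\<^sub>M M)"
      using I by (simp add: has_ito_integral_def M2_process_def adapted_process_def)
    have [measurable]: "case_prod (simple_process (N j) (\<tau> j) (\<zeta> j)) \<in>
        borel_measurable (restrict_space borel {0..T} \<Otimes>\<^sub>M M)"
      using measurable_simple_process[OF *[of j]]
      by (simp cong: measurable_cong_sets add: sets_time_product)
    have "(\<lambda>s. ennreal ((norm (case_prod Z s - case_prod (simple_process (N j) (\<tau> j) (\<zeta> j)) s))\<^sup>2))
       \<in> borel_measurable (restrict_space borel {0..T} \<Otimes>\<^sub>M M)"
      by measurable
    then show ?thesis
      using nn_integral_time_product[of M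
        "\<lambda>t \<omega>. ennreal ((norm (Z t \<omega> - simple_process (N j) (\<tau> j) (\<zeta> j) t \<omega>))\<^sup>2)" T]
      by (simp add: split_def sigma_finite_measure_axioms)
  qed
  then show thesis using that[OF * _ It] Z by simp
qed

text \<open>Square integrability of \<open>I t\<close> is not part of the definition. It holds
  because \<open>I t\<close> has finite L2 distance from some simple integral, which is square
  integrable.\<close>

lemma has_ito_integral_sq_integrable:
  assumes I: "has_ito_integral M F W T Z I" and t: "t \<in> {0..T}"
  shows "sq_integrable M (I t)"
proof -
  obtain N \<tau> \<zeta> where simple: "\<And>j. simple_integrand F T (N j) (\<tau> j) (\<zeta> j)"
    and "(\<lambda>j. \<integral>\<^sup>+s. ennreal ((norm (case_prod Z s - case_prod (simple_process (N j) (\<tau> j) (\<zeta> j)) s))\<^sup>2)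
       \<partial>(restrict_space lborel {0..T} \<Otimes>\<^sub>M M)) \<longlonglongrightarrow> 0"
    and "\<And>t. t \<in> {0..T} \<Longrightarrow> (\<lambda>j. \<integral>\<^sup>+\<omega>.
       ennreal ((norm (I t \<omega> - simple_ito_integral W (N j) (\<tau> j) (\<zeta> j) t \<omega>))\<^sup>2) \<partial>M) \<longlonglongrightarrow> 0"
    by (rule has_ito_integral_approx[OF I]) (rule that)
  then have lim: "(\<lambda>j. \<integral>\<^sup>+\<omega>.
       ennreal ((norm (I t \<omega> - simple_ito_integral W (N j) (\<tau> j) (\<zeta> j) t \<omega>))\<^sup>2) \<partial>M) \<longlonglongrightarrow> 0"
    using t by simp
  let ?S = "\<lambda>j. simple_ito_integral W (N j) (\<tau> j) (\<zeta> j) t"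
  have S: "sq_integrable M (?S j)" for j
    using sq_integrable_simple_ito[OF simple[of j]] t by simp
  from order_tendstoD(2)[OF lim, of 1] obtain j where
    j: "(\<integral>\<^sup>+\<omega>. ennreal ((norm (I t \<omega> - ?S j \<omega>))\<^sup>2) \<partial>M) < 1"
    unfolding eventually_sequentially by auto
  have "I t \<in> borel_measurable M"
    using I t by (intro F_measurable[of _ t]) (auto simp: has_ito_integral_def adapted_process_def)
  then have "(\<lambda>\<omega>. I t \<omega> - ?S j \<omega>) \<in> borel_measurable M"
    using sq_integrable_measurable[OF S] by simp
  then have "sq_integrable M (\<lambda>\<omega>. I t \<omega> - ?S j \<omega>)"
    by (rule sq_integrableI) (use j in \<open>auto intro: order.strict_trans\<close>)
  from sq_integrable_add[OF this S[of j]] show ?thesis by simp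
qed

text \<open>The polarised isometry: both sides are limits along the two approximating sequences, and
  these agree term by term by \<open>simple_ito_isometry\<close>.\<close>

lemma ito_isometry:
  fixes Z Z' :: "real \<Rightarrow> 'w \<Rightarrow> real^'d^'m"
  assumes "0 \<le> T" and I: "has_ito_integral M F W T Z I" and I': "has_ito_integral M F W T Z' I'"
  shows "expectation (\<lambda>\<omega>. I T \<omega> \<bullet> I' T \<omega>) =
    (\<integral>s. case_prod Z s \<bullet> case_prod Z' s \<partial>(restrict_space lborel {0..T} \<Otimes>\<^sub>M M))"
proof -
  have T: "T \<in> {0..T}" using \<open>0 \<le> T\<close> by simp
  obtain N \<tau> \<zeta> where A: "\<And>j. simple_integrand F T (N j) (\<tau> j) (\<zeta> j)"
    and Z: "(\<lambda>j. \<integral>\<^sup>+s. ennreal ((norm (case_prod Z s - case_prod (simple_process (N j) (\<tau> j) (\<zeta> j)) s))\<^sup>2)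
       \<partial>(restrict_space lborel {0..T} \<Otimes>\<^sub>M M)) \<longlonglongrightarrow> 0"
    and IT: "\<And>t. t \<in> {0..T} \<Longrightarrow> (\<lambda>j. \<integral>\<^sup>+\<omega>.
       ennreal ((norm (I t \<omega> - simple_ito_integral W (N j) (\<tau> j) (\<zeta> j) t \<omega>))\<^sup>2) \<partial>M) \<longlonglongrightarrow> 0"
    by (rule has_ito_integral_approx[OF I]) (rule that)
  obtain N' \<tau>' \<zeta>' where A': "\<And>j. simple_integrand F T (N' j) (\<tau>' j) (\<zeta>' j)"
    and Z': "(\<lambda>j. \<integral>\<^sup>+s. ennreal ((norm (case_prod Z' s - case_prod (simple_process (N' j) (\<tau>' j) (\<zeta>' j)) s))\<^sup>2)
       \<partial>(restrict_space lborel {0..T} \<Otimes>\<^sub>M M)) \<longlonglongrightarrow> 0"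
    and IT': "\<And>t. t \<in> {0..T} \<Longrightarrow> (\<lambda>j. \<integral>\<^sup>+\<omega>.
       ennreal ((norm (I' t \<omega> - simple_ito_integral W (N' j) (\<tau>' j) (\<zeta>' j) t \<omega>))\<^sup>2) \<partial>M) \<longlonglongrightarrow> 0"
    by (rule has_ito_integral_approx[OF I']) (rule that)
  have "(\<lambda>j. expectation (\<lambda>\<omega>. simple_ito_integral W (N j) (\<tau> j) (\<zeta> j) T \<omega> \<bullet>
      simple_ito_integral W (N' j) (\<tau>' j) (\<zeta>' j) T \<omega>)) \<longlonglongrightarrow> expectation (\<lambda>\<omega>. I T \<omega> \<bullet> I' T \<omega>)"
    by (rule sq_integrable_inner_tendsto[OF has_ito_integral_sq_integrable[OF I T]
      sq_integrable_simple_ito[OF A \<open>0 \<le> T\<close>] has_ito_integral_sq_integrable[OF I' T]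
      sq_integrable_simple_ito[OF A' \<open>0 \<le> T\<close>] IT[OF T] IT'[OF T]])
  moreover have m: "M2_process M F T Z" "M2_process M F T Z'"
    using I I' by (auto simp: has_ito_integral_def)
  have "(\<lambda>j. \<integral>s. case_prod (simple_process (N j) (\<tau> j) (\<zeta> j)) s \<bullet>
      case_prod (simple_process (N' j) (\<tau>' j) (\<zeta>' j)) s \<partial>(restrict_space lborel {0..T} \<Otimes>\<^sub>M M)) \<longlonglongrightarrow>
    (\<integral>s. case_prod Z s \<bullet> case_prod Z' s \<partial>(restrict_space lborel {0..T} \<Otimes>\<^sub>M M))"
    by (rule sq_integrable_inner_tendsto[OF M2_process_sq_integrable[OF m(1)]
      simple_process_sq_integrable[OF A] M2_process_sq_integrable[OF m(2)]
      simple_process_sq_integrable[OF A'] Z Z'])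
  ultimately show ?thesis
    unfolding simple_ito_isometry[OF A A'] by (blast intro: LIMSEQ_unique)
qed

text \<open>Both sides are limits of tested simple integrals, at \<open>T\<close> and at
  \<open>s\<close>, with \<open>Y\<close> kept as a constant sequence.\<close>

lemma ito_integral_martingale:
  fixes Z :: "real \<Rightarrow> 'w \<Rightarrow> real^'d^'m"
  assumes I: "has_ito_integral M F W T Z I" and s: "0 \<le> s" "s \<le> T"
    and Y: "Y \<in> borel_measurable (F s)" "sq_integrable M Y"
  shows "expectation (\<lambda>\<omega>. Y \<omega> \<bullet> I T \<omega>) = expectation (\<lambda>\<omega>. Y \<omega> \<bullet> I s \<omega>)"
proof -
  obtain N \<tau> \<zeta> where A: "\<And>j. simple_integrand F T (N j) (\<tau> j) (\<zeta> j)"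
    and "(\<lambda>j. \<integral>\<^sup>+s. ennreal ((norm (case_prod Z s - case_prod (simple_process (N j) (\<tau> j) (\<zeta> j)) s))\<^sup>2)
       \<partial>(restrict_space lborel {0..T} \<Otimes>\<^sub>M M)) \<longlonglongrightarrow> 0"
    and lim: "\<And>t. t \<in> {0..T} \<Longrightarrow> (\<lambda>j. \<integral>\<^sup>+\<omega>.
       ennreal ((norm (I t \<omega> - simple_ito_integral W (N j) (\<tau> j) (\<zeta> j) t \<omega>))\<^sup>2) \<partial>M) \<longlonglongrightarrow> 0"
    by (rule has_ito_integral_approx[OF I]) (rule that)
  have "(\<lambda>j. expectation (\<lambda>\<omega>. Y \<omega> \<bullet> simple_ito_integral W (N j) (\<tau> j) (\<zeta> j) t \<omega>))
      \<longlonglongrightarrow> expectation (\<lambda>\<omega>. Y \<omega> \<bullet> I t \<omega>)" if t: "t \<in> {0..T}" for t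
    using t by (intro sq_integrable_inner_tendsto[OF Y(2) Y(2) has_ito_integral_sq_integrable[OF I t]
      sq_integrable_simple_ito[OF A] _ lim[OF t]]) auto
  from this[of T] this[of s] s show ?thesis
    unfolding simple_ito_martingale[OF A s Y] by (auto intro: LIMSEQ_unique)
qed

text \<open>\<open>has_ito_integral\<close> fixes the initial value only through L2 limits of simple
  integrals, all of which vanish at 0 because no node is negative.\<close>

lemma ito_integral_start:
  assumes "0 \<le> T" and I: "has_ito_integral M F W T Z I" and Y: "sq_integrable M Y"
  shows "expectation (\<lambda>\<omega>. Y \<omega> \<bullet> I 0 \<omega>) = 0"
proof -
  have t: "0 \<in> {0..T}" using \<open>0 \<le> T\<close> by simp
  obtain N \<tau> \<zeta> where A: "\<And>j. simple_integrand F T (N j) (\<tau> j) (\<zeta> j)"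
    and "(\<lambda>j. \<integral>\<^sup>+s. ennreal ((norm (case_prod Z s - case_prod (simple_process (N j) (\<tau> j) (\<zeta> j)) s))\<^sup>2)
       \<partial>(restrict_space lborel {0..T} \<Otimes>\<^sub>M M)) \<longlonglongrightarrow> 0"
    and lim: "\<And>t. t \<in> {0..T} \<Longrightarrow> (\<lambda>j. \<integral>\<^sup>+\<omega>.
       ennreal ((norm (I t \<omega> - simple_ito_integral W (N j) (\<tau> j) (\<zeta> j) t \<omega>))\<^sup>2) \<partial>M) \<longlonglongrightarrow> 0"
    by (rule has_ito_integral_approx[OF I]) (rule that)
  have "(\<lambda>j. expectation (\<lambda>\<omega>. Y \<omega> \<bullet> simple_ito_integral W (N j) (\<tau> j) (\<zeta> j) 0 \<omega>))
      \<longlonglongrightarrow> expectation (\<lambda>\<omega>. Y \<omega> \<bullet> I 0 \<omega>)"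
    by (intro sq_integrable_inner_tendsto[OF Y Y has_ito_integral_sq_integrable[OF I t]
      sq_integrable_simple_ito[OF A] _ lim[OF t]]) auto
  moreover have "simple_ito_integral W (N j) (\<tau> j) (\<zeta> j) 0 \<omega> = 0" for j \<omega>
    unfolding simple_ito_integral_def
  proof (rule sum.neutral, rule ballI)
    fix i assume "i \<in> {..<N j}"
    with simple_integrandD(1,2)[OF A, of i j] have "min (\<tau> j (Suc i)) 0 = 0" "min (\<tau> j i) 0 = 0"
      by auto
    then show "\<zeta> j i \<omega> *v (W (min (\<tau> j (Suc i)) 0) \<omega> - W (min (\<tau> j i) 0) \<omega>) = 0" by simp
  qed
  ultimately show ?thesis by (simp add: LIMSEQ_const_iff)
qed

text \<open>The isometry of \<open>I\<close> with itself makes \<open>I T\<close> vanish; testing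
  the martingale property against \<open>I t\<close> then gives
  \<open>E |I t|^2 = E (I t \<bullet> I T) = 0\<close>. This is what makes \<open>k\<close>
  constant.\<close>

lemma ito_integral_zero_integrand:
  assumes I: "has_ito_integral M F W T Z I" and t: "t \<in> {0..T}"
    and Z: "\<And>t \<omega>. t \<in> {0..T} \<Longrightarrow> \<omega> \<in> space M \<Longrightarrow> Z t \<omega> = 0"
  shows "AE \<omega> in M. I t \<omega> = 0"
proof -
  have T: "0 \<le> T" "T \<in> {0..T}" using t by auto
  have AE0: "AE \<omega> in M. X \<omega> = 0" if X: "sq_integrable M X" and "expectation (\<lambda>\<omega>. X \<omega> \<bullet> X \<omega>) = 0" for X :: "'w \<Rightarrow> 'b::euclidean_space"
    using integral_nonneg_eq_0_iff_AE[OF sq_integrable_inner[OF X X]] that by simp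
  have "(\<integral>s. case_prod Z s \<bullet> case_prod Z s \<partial>(restrict_space lborel {0..T} \<Otimes>\<^sub>M M)) =
      (\<integral>s. 0 \<partial>(restrict_space lborel {0..T} \<Otimes>\<^sub>M M))"
    using Z by (intro Bochner_Integration.integral_cong refl) (auto simp: space_pair_measure)
  then have "AE \<omega> in M. I T \<omega> = 0"
    using ito_isometry[OF T(1) I I] by (intro AE0 has_ito_integral_sq_integrable[OF I T(2)]) simp
  then have "expectation (\<lambda>\<omega>. I t \<omega> \<bullet> I T \<omega>) = 0"
    by (intro integral_eq_zero_AE) auto
  moreover have "I t \<in> borel_measurable (F t)"
    using I t by (auto simp: has_ito_integral_def adapted_process_def)
  ultimately show ?thesis
    using ito_integral_martingale[OF I, of t "I t"] t has_ito_integral_sq_integrable[OF I t]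
    by (intro AE0) auto
qed

end

section \<open>The Hamiltonian and driftless processes\<close>

text \<open>For fixed multipliers the Hamiltonian is bounded by
  \<open>C + norm p * C + norm P * C + norm k * C\<close>, hence constant. Setting all multipliers
  to 0 isolates \<open>l\<close>; the other coefficients are recovered from their inner products
  with arbitrary vectors.\<close>

lemma hamiltonian_convex_imp_coefficients_const:
  fixes b :: "real \<Rightarrow> real^'n \<Rightarrow> real^'k \<Rightarrow> real^'n"
    and \<sigma> :: "real \<Rightarrow> real^'n \<Rightarrow> real^'k \<Rightarrow> real^'d^'n"
    and f :: "real \<Rightarrow> real^'n \<Rightarrow> real^'m \<Rightarrow> real^'d^'m \<Rightarrow> real^'k \<Rightarrow> real^'m"
  assumes cvx: "\<And>k p P. convex_on UNIV (\<lambda>(x, y, z). hamiltonian b \<sigma> f l t x y z v k p P)"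
    and bd: "\<And>x y z. norm (b t x v) \<le> C \<and> norm (\<sigma> t x v) \<le> C \<and> norm (f t x y z v) \<le> C \<and>
      \<bar>l t x y z v\<bar> \<le> C"
  shows "l t x y z v = l t x' y' z' v" "b t x v = b t x' v" "\<sigma> t x v = \<sigma> t x' v"
    "f t x y z v = f t x' y' z' v"
proof -
  have H: "hamiltonian b \<sigma> f l t x y z v k p P = hamiltonian b \<sigma> f l t x' y' z' v k p P" for k p P
  proof -
    have "\<bar>hamiltonian b \<sigma> f l t x y z v k p P\<bar> \<le> C + norm p * C + norm P * C + norm k * C" for x y z
    proof -
      have "\<bar>c \<bullet> a\<bar> \<le> norm c * C" if "norm a \<le> C" for c a :: "'z::real_inner"
        using Cauchy_Schwarz_ineq2[of c a] mult_left_mono[OF that norm_ge_zero[of c]] by linarith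
      then have "\<bar>p \<bullet> b t x v\<bar> \<le> norm p * C" "\<bar>P \<bullet> \<sigma> t x v\<bar> \<le> norm P * C"
        "\<bar>k \<bullet> f t x y z v\<bar> \<le> norm k * C"
        using bd by blast+
      moreover have "\<bar>l t x y z v\<bar> \<le> C" using bd by blast
      ultimately show ?thesis unfolding hamiltonian_def by linarith
    qed
    then show ?thesis
      using bounded_convex_imp_const[OF cvx, of k p P _ "(x, y, z)" "(x', y', z')"] by auto
  qed
  show l: "l t x y z v = l t x' y' z' v"
    using H[of 0 0 0] by (simp add: hamiltonian_def)
  have "p \<bullet> b t x v = p \<bullet> b t x' v" for p
    using H[of 0 p 0] l by (simp add: hamiltonian_def)
  then show "b t x v = b t x' v" using vector_eq_ldot by blast
  have "P \<bullet> \<sigma> t x v = P \<bullet> \<sigma> t x' v" for P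
    using H[of 0 0 P] l by (simp add: hamiltonian_def)
  then show "\<sigma> t x v = \<sigma> t x' v" using vector_eq_ldot by blast
  have "k \<bullet> f t x y z v = k \<bullet> f t x' y' z' v" for k
    using H[of k 0 0] l by (simp add: hamiltonian_def)
  then show "f t x y z v = f t x' y' z' v" using vector_eq_ldot by blast
qed

lemma emeasure_time_less_top: "emeasure (restrict_space lborel {0..T::real}) A < \<top>"
  using finite_measure.emeasure_finite[OF finite_measure_time, of T A]
  by (simp only: less_top infinity_ennreal_def)

text \<open>Even without dependence on time or control the derivative is quantified over
  \<open>{0..T}\<close> and \<open>U\<close>; a point of each is needed to extract it.\<close>

lemma C1_bounded_derivative_imp_differentiable:
  assumes "C1_bounded_derivative T U (\<lambda>t a v. \<phi> a)" "0 \<le> T" "U \<noteq> {}"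
  obtains D where "\<And>a. (\<phi> has_derivative blinfun_apply (D a)) (at a)"
proof -
  from assms(3) obtain v where "v \<in> U" by auto
  moreover have "0 \<in> {0..T}" using assms(2) by simp
  moreover obtain D where "\<forall>t\<in>{0..T}. \<forall>v\<in>U. \<forall>a. (\<phi> has_derivative blinfun_apply (D t a v)) (at a)"
    using assms(1) unfolding C1_bounded_derivative_def by blast
  ultimately show thesis using that[of "\<lambda>a. D 0 a v"] by blast
qed

section \<open>Duality between a driftless process and an Ito process\<close>

context brownian_space
begin

lemma S2_process_sq_integrable:
  assumes X: "S2_process M F T X" and t: "t \<in> {0..T}"
  shows "sq_integrable M (X t)"
proof (rule sq_integrableI)
  show "X t \<in> borel_measurable M"
    using X t by (intro F_measurable[of _ t]) (auto simp: S2_process_def adapted_process_def)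
  have "(\<integral>\<^sup>+\<omega>. ennreal ((norm (X t \<omega>))\<^sup>2) \<partial>M) \<le>
      (\<integral>\<^sup>+\<omega>. (SUP t\<in>{0..T}. ennreal ((norm (X t \<omega>))\<^sup>2)) \<partial>M)"
    using t by (intro nn_integral_mono SUP_upper)
  then show "(\<integral>\<^sup>+\<omega>. ennreal ((norm (X t \<omega>))\<^sup>2) \<partial>M) < \<infinity>"
    using X unfolding S2_process_def sup_square_integrable_def by (meson le_less_trans)
qed

text \<open>The time integral is at most the length of \<open>{0..T}\<close> times the supremum. It
  makes \<open>p\<close> and \<open>k\<close> available as L2 functions over the product.\<close>

lemma S2_process_imp_M2_process:
  assumes X: "S2_process M F T X"
  shows "M2_process M F T X"
proof -
  interpret T: finite_measure "restrict_space lborel {0..T}" by (rule finite_measure_time)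
  let ?L = "restrict_space lborel {0..T}"
  let ?S = "\<integral>\<^sup>+\<omega>. (SUP t\<in>{0..T}. ennreal ((norm (X t \<omega>))\<^sup>2)) \<partial>M"
  have ad: "adapted_process M F T X" using X by (simp add: S2_process_def)
  have [measurable]: "case_prod X \<in> borel_measurable (?L \<Otimes>\<^sub>M M)"
    using measurable_adapted_process[OF ad] .
  have [measurable]: "case_prod X \<in> borel_measurable (restrict_space borel {0..T} \<Otimes>\<^sub>M M)"
    using ad by (simp add: adapted_process_def)
  have m: "(\<lambda>s. ennreal ((norm (case_prod X s))\<^sup>2)) \<in> borel_measurable (restrict_space borel {0..T} \<Otimes>\<^sub>M M)"
    by measurable
  have m': "(\<lambda>s. ennreal ((norm (case_prod X s))\<^sup>2)) \<in> borel_measurable (?L \<Otimes>\<^sub>M M)"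
    by measurable
  have "(\<integral>\<^sup>+\<omega>. (\<integral>\<^sup>+t\<in>{0..T}. ennreal ((norm (X t \<omega>))\<^sup>2) \<partial>lborel) \<partial>M) =
      (\<integral>\<^sup>+s. ennreal ((norm (case_prod X s))\<^sup>2) \<partial>(?L \<Otimes>\<^sub>M M))"
    using nn_integral_time_product[of M "\<lambda>t \<omega>. ennreal ((norm (X t \<omega>))\<^sup>2)" T] m
    by (simp add: split_def sigma_finite_measure_axioms)
  also have "\<dots> = (\<integral>\<^sup>+t. (\<integral>\<^sup>+\<omega>. ennreal ((norm (X t \<omega>))\<^sup>2) \<partial>M) \<partial>?L)"
    using nn_integral_fst[OF m'] by simp
  also have "\<dots> \<le> (\<integral>\<^sup>+t. ?S \<partial>?L)"
    by (intro nn_integral_mono SUP_upper) (auto simp: space_restrict_space)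
  also have "\<dots> = ?S * emeasure ?L (space ?L)" by simp
  also have "\<dots> < \<infinity>"
    using X emeasure_time_less_top[of T] unfolding S2_process_def sup_square_integrable_def
    by (simp add: ennreal_mult_less_top)
  finally show ?thesis using ad unfolding M2_process_def by simp
qed

lemma driftless_ito_differential:
  assumes p: "ito_differential M F W T p c Q"
    and c: "\<And>t \<omega>. t \<in> {0..T} \<Longrightarrow> \<omega> \<in> space M \<Longrightarrow> c t \<omega> = 0"
  obtains I where "has_ito_integral M F W T Q I"
    "\<And>t. t \<in> {0..T} \<Longrightarrow> AE \<omega> in M. p t \<omega> = p 0 \<omega> + I t \<omega>"
proof -
  obtain I where I: "has_ito_integral M F W T Q I"
    and pI: "AE \<omega> in M. \<forall>t\<in>{0..T}. p t \<omega> = p 0 \<omega> + (LINT s:{0..t}|lborel. c s \<omega>) + I t \<omega>"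
    using p[unfolded ito_differential_def] by (elim conjE exE) (rule that)
  have "AE \<omega> in M. p t \<omega> = p 0 \<omega> + I t \<omega>" if t: "t \<in> {0..T}" for t
  proof (rule AE_mp[OF pI], rule AE_I2, rule impI)
    fix \<omega> assume \<omega>: "\<omega> \<in> space M"
      and "\<forall>t\<in>{0..T}. p t \<omega> = p 0 \<omega> + (LINT s:{0..t}|lborel. c s \<omega>) + I t \<omega>"
    then have "p t \<omega> = p 0 \<omega> + (LINT s:{0..t}|lborel. c s \<omega>) + I t \<omega>"
      using t by blast
    moreover have "indicator {0..t} s *\<^sub>R c s \<omega> = 0" for s
      using t c[of s \<omega>] \<omega> by (cases "s \<in> {0..t}") simp_all
    ultimately show "p t \<omega> = p 0 \<omega> + I t \<omega>" by (simp add: set_lebesgue_integral_def)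
  qed
  with I show thesis by (rule that)
qed

text \<open>Write \<open>X T - X 0\<close> as drift integral plus \<open>K T\<close>, and
  \<open>p T\<close> as \<open>p 0 + I T\<close>. The product \<open>p 0 \<bullet> K T\<close> has
  mean zero, \<open>I T \<bullet> K T\<close> is given by the isometry, and in the drift part Fubini
  and the martingale property turn \<open>p T\<close> into \<open>p t\<close>, since
  \<open>a t\<close> is known at time \<open>t\<close>.\<close>

lemma expectation_martingale_product:
  fixes p X :: "real \<Rightarrow> 'w \<Rightarrow> real^'m"
  assumes T: "0 \<le> T" and p: "S2_process M F T p" "ito_differential M F W T p c Q"
    and c: "\<And>t \<omega>. t \<in> {0..T} \<Longrightarrow> \<omega> \<in> space M \<Longrightarrow> c t \<omega> = 0"
    and X: "S2_process M F T X" "ito_differential M F W T X a B"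
    and a: "\<And>t \<omega>. t \<in> {0..T} \<Longrightarrow> \<omega> \<in> space M \<Longrightarrow> norm (a t \<omega>) \<le> C"
  shows "expectation (\<lambda>\<omega>. p T \<omega> \<bullet> (X T \<omega> - X 0 \<omega>)) =
    (\<integral>s. case_prod p s \<bullet> case_prod a s \<partial>(restrict_space lborel {0..T} \<Otimes>\<^sub>M M)) +
    (\<integral>s. case_prod Q s \<bullet> case_prod B s \<partial>(restrict_space lborel {0..T} \<Otimes>\<^sub>M M))"
proof -
  interpret T: finite_measure "restrict_space lborel {0..T}" by (rule finite_measure_time)
  interpret TM: finite_measure "restrict_space lborel {0..T} \<Otimes>\<^sub>M M"
    by (rule finite_measure_pair_measure) unfold_locales
  interpret pair_sigma_finite "restrict_space lborel {0..T}" M ..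
  let ?L = "restrict_space lborel {0..T}"
  let ?TM = "?L \<Otimes>\<^sub>M M"
  have T': "0 \<in> {0..T}" "T \<in> {0..T}" using T by auto
  obtain I where I: "has_ito_integral M F W T Q I"
    and p_eq: "\<And>t. t \<in> {0..T} \<Longrightarrow> AE \<omega> in M. p t \<omega> = p 0 \<omega> + I t \<omega>"
    by (rule driftless_ito_differential[OF p(2) c]) (assumption+, rule that)
  obtain K where K: "has_ito_integral M F W T B K"
    and XK: "AE \<omega> in M. \<forall>t\<in>{0..T}. X t \<omega> = X 0 \<omega> + (LINT s:{0..t}|lborel. a s \<omega>) + K t \<omega>"
    and a_ad: "adapted_process M F T a"
    using X(2)[unfolded ito_differential_def] by (elim conjE exE) (rule that)
  note sq_p = S2_process_sq_integrable[OF p(1)]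
  note sq_I = has_ito_integral_sq_integrable[OF I]
  note sq_K = has_ito_integral_sq_integrable[OF K]
  have p_F: "p t \<in> borel_measurable (F t)" if "t \<in> {0..T}" for t
    using p(1) that by (auto simp: S2_process_def adapted_process_def)
  have a_F: "a t \<in> borel_measurable (F t)" if "t \<in> {0..T}" for t
    using a_ad that by (auto simp: adapted_process_def)
  have sq_a: "sq_integrable M (a t)" if "t \<in> {0..T}" for t
    using a[OF that] by (intro sq_integrable_bounded F_measurable[OF a_F[OF that]])
  have a_TM [measurable]: "case_prod a \<in> borel_measurable ?TM"
    using measurable_adapted_process[OF a_ad] .
  have sq_aTM: "sq_integrable ?TM (case_prod a)"
    by (rule TM.sq_integrable_bounded[where C = C]) (auto simp: space_pair_measure intro!: a)
  have [measurable]: "p T \<in> borel_measurable M"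
    using sq_integrable_measurable[OF sq_p[OF T'(2)]] .
  \<comment> \<open>Viewed as constant in time, \<open>p T\<close> is in L2 over the product; this
    justifies Fubini for \<open>p T \<bullet> a t\<close>.\<close>
  have sq_pT: "sq_integrable ?TM (\<lambda>s. p T (snd s))"
  proof (rule sq_integrableI)
    have "(\<integral>\<^sup>+s. ennreal ((norm (p T (snd s)))\<^sup>2) \<partial>?TM) =
        (\<integral>\<^sup>+t. (\<integral>\<^sup>+\<omega>. ennreal ((norm (p T \<omega>))\<^sup>2) \<partial>M) \<partial>?L)"
      by (subst nn_integral_fst[symmetric]) auto
    also have "\<dots> = (\<integral>\<^sup>+\<omega>. ennreal ((norm (p T \<omega>))\<^sup>2) \<partial>M) * emeasure ?L (space ?L)"
      by simp
    also have "\<dots> < \<infinity>"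
      using nn_integral_eq_integral[OF sq_integrable_norm[OF sq_p[OF T'(2)]]] emeasure_time_less_top[of T]
      by (simp add: ennreal_mult_less_top)
    finally show "(\<integral>\<^sup>+s. ennreal ((norm (p T (snd s)))\<^sup>2) \<partial>?TM) < \<infinity>" .
  qed measurable
  have int_pTa: "integrable ?TM (case_prod (\<lambda>t \<omega>. p T \<omega> \<bullet> a t \<omega>))"
    using sq_integrable_inner[OF sq_pT sq_aTM] by (simp add: split_def)
  have int_pa: "integrable ?TM (case_prod (\<lambda>t \<omega>. p t \<omega> \<bullet> a t \<omega>))"
    using sq_integrable_inner[OF M2_process_sq_integrable[OF S2_process_imp_M2_process[OF p(1)]] sq_aTM]
    by (simp add: split_def)
  have drift: "p T \<omega> \<bullet> (LINT s:{0..T}|lborel. a s \<omega>) = (\<integral>t. p T \<omega> \<bullet> a t \<omega> \<partial>?L)"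
    if \<omega>: "\<omega> \<in> space M" for \<omega>
  proof -
    have "(\<lambda>t. a t \<omega>) \<in> borel_measurable ?L"
      using measurable_Pair1[OF a_TM \<omega>] by simp
    then have "integrable ?L (\<lambda>t. a t \<omega>)"
      using \<omega> by (intro T.integrable_const_bound[where B = C] AE_I2) (auto intro!: a)
    then have "(\<integral>t. p T \<omega> \<bullet> a t \<omega> \<partial>?L) = p T \<omega> \<bullet> (\<integral>t. a t \<omega> \<partial>?L)"
      by (intro integral_inner_right)
    moreover have "(\<integral>t. a t \<omega> \<partial>?L) = (LINT s:{0..T}|lborel. a s \<omega>)"
      unfolding set_lebesgue_integral_def by (rule integral_restrict_space) simp
    ultimately show ?thesis by simp
  qed
  have "AE \<omega> in M. p T \<omega> \<bullet> (X T \<omega> - X 0 \<omega>) =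
      (\<integral>t. p T \<omega> \<bullet> a t \<omega> \<partial>?L) + p 0 \<omega> \<bullet> K T \<omega> + I T \<omega> \<bullet> K T \<omega>"
  proof (rule AE_mp[OF AE_conjI[OF XK p_eq[OF T'(2)]]], rule AE_I2, rule impI)
    fix \<omega> assume \<omega>: "\<omega> \<in> space M"
      and *: "(\<forall>t\<in>{0..T}. X t \<omega> = X 0 \<omega> + (LINT s:{0..t}|lborel. a s \<omega>) + K t \<omega>) \<and>
         p T \<omega> = p 0 \<omega> + I T \<omega>"
    then have "X T \<omega> = X 0 \<omega> + (LINT s:{0..T}|lborel. a s \<omega>) + K T \<omega>"
      using T'(2) by blast
    then have "X T \<omega> - X 0 \<omega> = (LINT s:{0..T}|lborel. a s \<omega>) + K T \<omega>"
      by simp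
    moreover have "p T \<omega> \<bullet> K T \<omega> = p 0 \<omega> \<bullet> K T \<omega> + I T \<omega> \<bullet> K T \<omega>"
      unfolding conjunct2[OF *] by (rule inner_add_left)
    ultimately show "p T \<omega> \<bullet> (X T \<omega> - X 0 \<omega>) =
      (\<integral>t. p T \<omega> \<bullet> a t \<omega> \<partial>?L) + p 0 \<omega> \<bullet> K T \<omega> + I T \<omega> \<bullet> K T \<omega>"
      using drift[OF \<omega>] by (simp add: inner_add_right)
  qed
  then have "expectation (\<lambda>\<omega>. p T \<omega> \<bullet> (X T \<omega> - X 0 \<omega>)) =
      expectation (\<lambda>\<omega>. (\<integral>t. p T \<omega> \<bullet> a t \<omega> \<partial>?L) + p 0 \<omega> \<bullet> K T \<omega> + I T \<omega> \<bullet> K T \<omega>)"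
    using sq_integrable_measurable[OF S2_process_sq_integrable[OF X(1)]] T'
      integrable_snd[OF int_pTa]
      sq_integrable_inner[OF sq_p[OF T'(1)] sq_K[OF T'(2)]]
      sq_integrable_inner[OF sq_I[OF T'(2)] sq_K[OF T'(2)]]
    by (intro integral_cong_AE) auto
  also have "\<dots> = expectation (\<lambda>\<omega>. \<integral>t. p T \<omega> \<bullet> a t \<omega> \<partial>?L) + expectation (\<lambda>\<omega>. p 0 \<omega> \<bullet> K T \<omega>) +
      expectation (\<lambda>\<omega>. I T \<omega> \<bullet> K T \<omega>)"
    using integrable_snd[OF int_pTa]
      sq_integrable_inner[OF sq_p[OF T'(1)] sq_K[OF T'(2)]]
      sq_integrable_inner[OF sq_I[OF T'(2)] sq_K[OF T'(2)]]
    by simp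
  \<comment> \<open>The martingale property between 0 and \<open>T\<close>, tested against
    \<open>p 0\<close>, followed by the vanishing initial value.\<close>
  also have "expectation (\<lambda>\<omega>. p 0 \<omega> \<bullet> K T \<omega>) = 0"
    using ito_integral_martingale[OF K _ T p_F[OF T'(1)] sq_p[OF T'(1)]]
      ito_integral_start[OF T K sq_p[OF T'(1)]] by simp
  also have "expectation (\<lambda>\<omega>. I T \<omega> \<bullet> K T \<omega>) = (\<integral>s. case_prod Q s \<bullet> case_prod B s \<partial>?TM)"
    by (rule ito_isometry[OF T I K])
  also have "expectation (\<lambda>\<omega>. \<integral>t. p T \<omega> \<bullet> a t \<omega> \<partial>?L) = (\<integral>t. expectation (\<lambda>\<omega>. p T \<omega> \<bullet> a t \<omega>) \<partial>?L)"
    using Fubini_integral[OF int_pTa] .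
  also have "\<dots> = (\<integral>t. expectation (\<lambda>\<omega>. p t \<omega> \<bullet> a t \<omega>) \<partial>?L)"
  proof (rule Bochner_Integration.integral_cong[OF refl])
    fix t assume "t \<in> space ?L"
    then have t: "t \<in> {0..T}" by (simp add: space_restrict_space)
    \<comment> \<open>The martingale property is available for \<open>I\<close>, so
      \<open>p s\<close> is first split into \<open>p 0 + I s\<close>, for \<open>s\<close> equal to
      \<open>T\<close> and to \<open>t\<close>.\<close>
    have split: "expectation (\<lambda>\<omega>. p s \<omega> \<bullet> a t \<omega>) =
        expectation (\<lambda>\<omega>. p 0 \<omega> \<bullet> a t \<omega>) + expectation (\<lambda>\<omega>. a t \<omega> \<bullet> I s \<omega>)" if s: "s \<in> {0..T}" for s
    proof -
      have "AE \<omega> in M. p s \<omega> \<bullet> a t \<omega> = p 0 \<omega> \<bullet> a t \<omega> + a t \<omega> \<bullet> I s \<omega>"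
        using p_eq[OF s] by eventually_elim (metis inner_add_left inner_commute)
      then have "expectation (\<lambda>\<omega>. p s \<omega> \<bullet> a t \<omega>) =
          expectation (\<lambda>\<omega>. p 0 \<omega> \<bullet> a t \<omega> + a t \<omega> \<bullet> I s \<omega>)"
        using sq_integrable_inner[OF sq_p[OF s] sq_a[OF t]]
          sq_integrable_inner[OF sq_p[OF T'(1)] sq_a[OF t]]
          sq_integrable_inner[OF sq_a[OF t] sq_I[OF s]]
        by (intro integral_cong_AE borel_measurable_add borel_measurable_integrable)
      also have "\<dots> = expectation (\<lambda>\<omega>. p 0 \<omega> \<bullet> a t \<omega>) + expectation (\<lambda>\<omega>. a t \<omega> \<bullet> I s \<omega>)"
        using sq_integrable_inner[OF sq_p[OF T'(1)] sq_a[OF t]]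
          sq_integrable_inner[OF sq_a[OF t] sq_I[OF s]] by simp
      finally show ?thesis .
    qed
    show "expectation (\<lambda>\<omega>. p T \<omega> \<bullet> a t \<omega>) = expectation (\<lambda>\<omega>. p t \<omega> \<bullet> a t \<omega>)"
      unfolding split[OF T'(2)] split[OF t]
      using ito_integral_martingale[OF I _ _ a_F[OF t] sq_a[OF t]] t by simp
  qed
  also have "\<dots> = (\<integral>s. case_prod p s \<bullet> case_prod a s \<partial>?TM)"
    using integral_fst[OF int_pa] by (simp add: split_def)
  finally show ?thesis by simp
qed

end

section \<open>Integrability of the cost, vanishing gradients, comparison of time integrals\<close>

lemma (in finite_measure) sq_integrable_imp_integrable_norm:
  assumes "sq_integrable M X"
  shows "integrable M (\<lambda>\<omega>. norm (X \<omega>))"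
proof -
  have "sq_integrable M (\<lambda>\<omega>. norm (X \<omega>))"
    using assms by (auto simp: sq_integrable_def)
  from sq_integrable_inner[OF this, of "\<lambda>_. 1"] show ?thesis
    by (simp add: sq_integrable_def)
qed

lemma (in finite_measure) integrable_linear_growth:
  fixes \<phi> :: "'b::euclidean_space \<Rightarrow> real"
  assumes "\<phi> \<in> borel_measurable borel" "\<And>a. \<bar>\<phi> a\<bar> \<le> C * (1 + norm a)" "sq_integrable M X"
  shows "integrable M (\<lambda>\<omega>. \<phi> (X \<omega>))"
proof (rule Bochner_Integration.integrable_bound)
  show "integrable M (\<lambda>\<omega>. C * (1 + norm (X \<omega>)))"
    using sq_integrable_imp_integrable_norm[OF assms(3)] by simp
  show "(\<lambda>\<omega>. \<phi> (X \<omega>)) \<in> borel_measurable M"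
    using sq_integrable_measurable[OF assms(3)] assms(1) by (rule measurable_compose)
  show "AE \<omega> in M. norm (\<phi> (X \<omega>)) \<le> norm (C * (1 + norm (X \<omega>)))"
    using order_trans[OF assms(2) abs_ge_self] by (auto intro!: AE_I2)
qed

text \<open>All coefficients are constant in the state, hence so is each partial map. Along
  \<open>u\<close> this removes the drifts of \<open>k\<close> and \<open>p\<close> and the
  diffusion term of \<open>k\<close>.\<close>

lemma hamiltonian_gradient_zero:
  fixes b :: "real \<Rightarrow> real^'n \<Rightarrow> real^'k \<Rightarrow> real^'n"
    and \<sigma> :: "real \<Rightarrow> real^'n \<Rightarrow> real^'k \<Rightarrow> real^'d^'n"
    and f :: "real \<Rightarrow> real^'n \<Rightarrow> real^'m \<Rightarrow> real^'d^'m \<Rightarrow> real^'k \<Rightarrow> real^'m"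
  assumes cvx: "\<And>k p P. convex_on UNIV (\<lambda>(x, y, z). hamiltonian b \<sigma> f l t x y z v k p P)"
    and bd: "\<And>x y z. norm (b t x v) \<le> C \<and> norm (\<sigma> t x v) \<le> C \<and> norm (f t x y z v) \<le> C \<and>
      \<bar>l t x y z v\<bar> \<le> C"
  shows "gradient (\<lambda>\<theta>. hamiltonian b \<sigma> f l t \<theta> y z v k p P) x = 0"
    and "gradient (\<lambda>\<eta>. hamiltonian b \<sigma> f l t x \<eta> z v k p P) y = 0"
    and "gradient (\<lambda>\<zeta>. hamiltonian b \<sigma> f l t x y \<zeta> v k p P) z = 0"
proof -
  note const = hamiltonian_convex_imp_coefficients_const[OF cvx bd]
  have eq: "hamiltonian b \<sigma> f l t x y z v k p P = hamiltonian b \<sigma> f l t 0 0 0 v k p P" for x y z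
    unfolding hamiltonian_def
    using const(1)[of x y z 0 0 0] const(2)[of x 0] const(3)[of x 0] const(4)[of x y z 0 0 0] by simp
  show "gradient (\<lambda>\<theta>. hamiltonian b \<sigma> f l t \<theta> y z v k p P) x = 0"
    "gradient (\<lambda>\<eta>. hamiltonian b \<sigma> f l t x \<eta> z v k p P) y = 0"
    "gradient (\<lambda>\<zeta>. hamiltonian b \<sigma> f l t x y \<zeta> v k p P) z = 0"
    by (subst eq, rule gradient_const)+
qed

context brownian_space
begin

text \<open>The inequality holds for almost every \<open>t\<close>, almost surely, with an
  exceptional event that may depend on \<open>t\<close>. Comparing expectations at each such
  \<open>t\<close> and then integrating in time respects this order of quantifiers.\<close>

lemma integral_time_product_mono:
  fixes \<phi> \<psi> :: "real \<times> 'w \<Rightarrow> real"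
  assumes int: "integrable (restrict_space lborel {0..T} \<Otimes>\<^sub>M M) \<phi>"
      "integrable (restrict_space lborel {0..T} \<Otimes>\<^sub>M M) \<psi>"
    and le: "AE t in lborel. t \<in> {0..T} \<longrightarrow> (AE \<omega> in M. \<phi> (t, \<omega>) \<le> \<psi> (t, \<omega>))"
  shows "integral\<^sup>L (restrict_space lborel {0..T} \<Otimes>\<^sub>M M) \<phi> \<le>
    integral\<^sup>L (restrict_space lborel {0..T} \<Otimes>\<^sub>M M) \<psi>"
proof -
  interpret T: finite_measure "restrict_space lborel {0..T}" by (rule finite_measure_time)
  interpret pair_sigma_finite "restrict_space lborel {0..T}" M ..
  have "AE t in restrict_space lborel {0..T}. AE \<omega> in M. \<phi> (t, \<omega>) \<le> \<psi> (t, \<omega>)"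
    using le by (subst AE_restrict_space_iff) auto
  with AE_integrable_fst'[OF int(1)] AE_integrable_fst'[OF int(2)]
  have "AE t in restrict_space lborel {0..T}.
      expectation (\<lambda>\<omega>. \<phi> (t, \<omega>)) \<le> expectation (\<lambda>\<omega>. \<psi> (t, \<omega>))"
    by eventually_elim (rule integral_mono_AE)
  then have "(\<integral>t. expectation (\<lambda>\<omega>. \<phi> (t, \<omega>)) \<partial>restrict_space lborel {0..T}) \<le>
      (\<integral>t. expectation (\<lambda>\<omega>. \<psi> (t, \<omega>)) \<partial>restrict_space lborel {0..T})"
    by (rule integral_mono_AE[OF integrable_fst'[OF int(1)] integrable_fst'[OF int(2)]])
  then show ?thesis
    unfolding integral_fst'[OF int(1)] integral_fst'[OF int(2)] .
qed

lemma measurable_time_product_time: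
  "fst \<in> borel_measurable (restrict_space lborel {0..T} \<Otimes>\<^sub>M M)"
proof -
  have "(\<lambda>t. t) \<in> borel_measurable (restrict_space lborel {0..T})"
    by (rule measurable_restrict_space1) simp
  from measurable_compose[OF measurable_fst this] show ?thesis .
qed

lemma bounded_time_integral:
  fixes a :: "real \<Rightarrow> 'w \<Rightarrow> real"
  assumes a: "case_prod a \<in> borel_measurable (restrict_space lborel {0..T} \<Otimes>\<^sub>M M)"
    and bd: "\<And>t \<omega>. t \<in> {0..T} \<Longrightarrow> \<omega> \<in> space M \<Longrightarrow> \<bar>a t \<omega>\<bar> \<le> C"
  shows "integrable (restrict_space lborel {0..T} \<Otimes>\<^sub>M M) (case_prod a)"
    and "integrable M (\<lambda>\<omega>. LINT t:{0..T}|lborel. a t \<omega>)"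
    and "expectation (\<lambda>\<omega>. LINT t:{0..T}|lborel. a t \<omega>) =
      (\<integral>s. case_prod a s \<partial>(restrict_space lborel {0..T} \<Otimes>\<^sub>M M))"
proof -
  interpret T: finite_measure "restrict_space lborel {0..T}" by (rule finite_measure_time)
  interpret TM: finite_measure "restrict_space lborel {0..T} \<Otimes>\<^sub>M M"
    by (rule finite_measure_pair_measure) unfold_locales
  interpret pair_sigma_finite "restrict_space lborel {0..T}" M ..
  show int: "integrable (restrict_space lborel {0..T} \<Otimes>\<^sub>M M) (case_prod a)"
    using a by (rule TM.integrable_const_bound[where B = C, rotated])
      (auto simp: space_pair_measure intro!: AE_I2 bd)
  have eq: "(LINT t:{0..T}|lborel. a t \<omega>) = (\<integral>t. a t \<omega> \<partial>restrict_space lborel {0..T})" for \<omega>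
    unfolding set_lebesgue_integral_def by (rule integral_restrict_space[symmetric]) simp
  show "integrable M (\<lambda>\<omega>. LINT t:{0..T}|lborel. a t \<omega>)"
    unfolding eq by (rule integrable_snd[OF int])
  show "expectation (\<lambda>\<omega>. LINT t:{0..T}|lborel. a t \<omega>) =
      (\<integral>s. case_prod a s \<partial>(restrict_space lborel {0..T} \<Otimes>\<^sub>M M))"
    unfolding eq by (rule integral_snd[OF int])
qed

end

theorem theorem20:
  fixes M :: "'w measure"
    and F :: "real \<Rightarrow> 'w measure"
    and W :: "real \<Rightarrow> 'w \<Rightarrow> real^'d"
    and T :: real
    and U :: "(real^'k) set"
    and b :: "real \<Rightarrow> real^'n \<Rightarrow> real^'k \<Rightarrow> real^'n"
    and \<sigma> :: "real \<Rightarrow> real^'n \<Rightarrow> real^'k \<Rightarrow> real^'d^'n"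
    and f :: "real \<Rightarrow> real^'n \<Rightarrow> real^'m \<Rightarrow> real^'d^'m \<Rightarrow> real^'k \<Rightarrow> real^'m"
    and g :: "real^'n \<Rightarrow> real"
    and h :: "real^'m \<Rightarrow> real"
    and l :: "real \<Rightarrow> real^'n \<Rightarrow> real^'m \<Rightarrow> real^'d^'m \<Rightarrow> real^'k \<Rightarrow> real"
    and x0 :: "'w \<Rightarrow> real^'n"
    and \<xi> :: "'w \<Rightarrow> real^'m"
    and x :: "(real \<Rightarrow> 'w \<Rightarrow> real^'k) \<Rightarrow> real \<Rightarrow> 'w \<Rightarrow> real^'n"
    and y :: "(real \<Rightarrow> 'w \<Rightarrow> real^'k) \<Rightarrow> real \<Rightarrow> 'w \<Rightarrow> real^'m"
    and z :: "(real \<Rightarrow> 'w \<Rightarrow> real^'k) \<Rightarrow> real \<Rightarrow> 'w \<Rightarrow> real^'d^'m"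
    and u :: "real \<Rightarrow> 'w \<Rightarrow> real^'k"
    and k :: "real \<Rightarrow> 'w \<Rightarrow> real^'m"
    and p :: "real \<Rightarrow> 'w \<Rightarrow> real^'n"
    and P :: "real \<Rightarrow> 'w \<Rightarrow> real^'d^'n"
  defines "H \<equiv> hamiltonian b \<sigma> f l"
    and "J \<equiv> (\<lambda>v. cost M T g h l v (x v) (y v) (z v))"
  assumes "prob_space M"
    and "usual_conditions M F"
    and "brownian_motion M F W"
    and "\<And>t. 0 \<le> t \<Longrightarrow> sets (F t) = sets (augmented_natural_filtration M W t)"
    and "0 < T"
    and "compact U" and "U \<noteq> {}"
    and "standing_assumptions T U b \<sigma> f g h l"
    and "x0 \<in> borel_measurable (F 0)" and "integrable M (\<lambda>\<omega>. (norm (x0 \<omega>))\<^sup>2)"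
    and "\<xi> \<in> borel_measurable (F T)" and "integrable M (\<lambda>\<omega>. (norm (\<xi> \<omega>))\<^sup>2)"
    and "\<And>v. v \<in> strict_controls M F T U \<Longrightarrow>
           state_equation M F W T b \<sigma> f x0 \<xi> v (x v) (y v) (z v)"
    and "convex_on UNIV g" and "convex_on UNIV h"
    and "\<And>t v k p P. t \<in> {0..T} \<Longrightarrow> v \<in> U \<Longrightarrow>
           convex_on UNIV (\<lambda>(x, y, z). H t x y z v k p P)"
    and "u \<in> strict_controls M F T U"
    and "adjoint_equation M F W T H g h u (x u) (y u) (z u) k p P"
    and "\<And>v. v \<in> strict_controls M F T U \<Longrightarrow>
           AE t in lborel. t \<in> {0..T} \<longrightarrow>
             (AE \<omega> in M. H t (x u t \<omega>) (y u t \<omega>) (z u t \<omega>) (u t \<omega>) (k t \<omega>) (p t \<omega>) (P t \<omega>)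
                       \<le> H t (x u t \<omega>) (y u t \<omega>) (z u t \<omega>) (v t \<omega>) (k t \<omega>) (p t \<omega>) (P t \<omega>))"
  shows "ereal (J u) = (INF v \<in> strict_controls M F T U. ereal (J v))"
proof -
  from \<open>usual_conditions M F\<close> \<open>prob_space M\<close> \<open>brownian_motion M F W\<close>
  interpret brownian_space M F W
    by (simp add: brownian_space_def brownian_space_axioms_def usual_conditions_def)
  interpret TL: finite_measure "restrict_space lborel {0..T}" by (rule finite_measure_time)
  interpret TM: finite_measure "restrict_space lborel {0..T} \<Otimes>\<^sub>M M"
    by (rule finite_measure_pair_measure) unfold_locales
  let ?U = "strict_controls M F T U"
  let ?TM = "restrict_space lborel {0..T} \<Otimes>\<^sub>M M"
  note state = \<open>\<And>v. v \<in> strict_controls M F T U \<Longrightarrow>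
           state_equation M F W T b \<sigma> f x0 \<xi> v (x v) (y v) (z v)\<close>
  note standing = \<open>standing_assumptions T U b \<sigma> f g h l\<close>
  note adjoint = \<open>adjoint_equation M F W T H g h u (x u) (y u) (z u) k p P\<close>
  note u = \<open>u \<in> strict_controls M F T U\<close>
  have T: "0 \<le> T" "0 \<in> {0..T}" "T \<in> {0..T}" using \<open>0 < T\<close> by auto
  from \<open>U \<noteq> {}\<close> obtain v0 where v0: "v0 \<in> U" by auto
  obtain C where C: "\<forall>t\<in>{0..T}. \<forall>v\<in>U. \<forall>x y z.
        norm (b t x v) \<le> C \<and> norm (\<sigma> t x v) \<le> C \<and> norm (f t x y z v) \<le> C \<and> \<bar>l t x y z v\<bar> \<le> C"
    using standing unfolding standing_assumptions_def by blast
  obtain C' where C': "\<forall>t\<in>{0..T}. \<forall>v\<in>U. \<forall>x y z.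
        norm (b t x v) \<le> C' * (1 + norm x + norm v) \<and>
        norm (\<sigma> t x v) \<le> C' * (1 + norm x + norm v) \<and>
        norm (f t x y z v) \<le> C' * (1 + norm x + norm y + norm z + norm v) \<and>
        \<bar>g x\<bar> \<le> C' * (1 + norm x) \<and>
        \<bar>h y\<bar> \<le> C' * (1 + norm y) \<and>
        \<bar>l t x y z v\<bar> \<le> C' * (1 + norm x + norm y + norm z + norm v)"
    using standing unfolding standing_assumptions_def by blast
  \<comment> \<open>The growth bound is quantified over \<open>{0..T}\<close> and \<open>U\<close>;
    the time 0 and \<open>v0\<close> serve as witnesses.\<close>
  have g_growth: "\<bar>g a\<bar> \<le> C' * (1 + norm a)" and h_growth: "\<bar>h a'\<bar> \<le> C' * (1 + norm a')" for a a'
    using C' v0 T(2) by blast+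
  have l_meas: "(\<lambda>(t, x, y, z, v). l t x y z v)
        \<in> borel_measurable (restrict_space borel ({0..T} \<times> UNIV \<times> UNIV \<times> UNIV \<times> U))"
    and C1_g: "C1_bounded_derivative T U (\<lambda>t x v. g x)"
    and C1_h: "C1_bounded_derivative T U (\<lambda>t y v. h y)"
    using standing unfolding standing_assumptions_def by blast+
  obtain Dg where Dg: "\<And>a. (g has_derivative blinfun_apply (Dg a)) (at a)"
    by (rule C1_bounded_derivative_imp_differentiable[OF C1_g T(1) \<open>U \<noteq> {}\<close>]) (rule that)
  obtain Dh where Dh: "\<And>a. (h has_derivative blinfun_apply (Dh a)) (at a)"
    by (rule C1_bounded_derivative_imp_differentiable[OF C1_h T(1) \<open>U \<noteq> {}\<close>]) (rule that)
  have g_meas: "g \<in> borel_measurable borel" and h_meas: "h \<in> borel_measurable borel"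
    using has_derivative_continuous[OF Dg] has_derivative_continuous[OF Dh]
    by (auto intro!: borel_measurable_continuous_onI continuous_at_imp_continuous_on)
  have cvx: "convex_on UNIV (\<lambda>(x, y, z). hamiltonian b \<sigma> f l t x y z v k p P)"
    if "t \<in> {0..T}" "v \<in> U" for t v k p P
    using \<open>\<And>t v k p P. t \<in> {0..T} \<Longrightarrow> v \<in> U \<Longrightarrow> convex_on UNIV (\<lambda>(x, y, z). H t x y z v k p P)\<close>[OF that]
    unfolding H_def .
  have bd: "norm (b t x v) \<le> C \<and> norm (\<sigma> t x v) \<le> C \<and> norm (f t x y z v) \<le> C \<and> \<bar>l t x y z v\<bar> \<le> C"
    if "t \<in> {0..T}" "v \<in> U" for t v x y z
    using C that by blast
  have control_U: "w t \<omega> \<in> U" if "w \<in> ?U" "t \<in> {0..T}" "\<omega> \<in> space M" for w t \<omega>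
    using that by (simp add: strict_controls_def)
  have S2_k: "S2_process M F T k" and S2_p: "S2_process M F T p"
    and k0: "AE \<omega> in M. k 0 \<omega> = gradient h (y u 0 \<omega>)"
    and pT: "AE \<omega> in M. p T \<omega> = gradient g (x u T \<omega>)"
    using adjoint unfolding adjoint_equation_def by blast+
  let ?ck = "\<lambda>t \<omega>. gradient (\<lambda>\<eta>. H t (x u t \<omega>) \<eta> (z u t \<omega>) (u t \<omega>) (k t \<omega>) (p t \<omega>) (P t \<omega>)) (y u t \<omega>)"
  let ?Qk = "\<lambda>t \<omega>. gradient (\<lambda>\<zeta>. H t (x u t \<omega>) (y u t \<omega>) \<zeta> (u t \<omega>) (k t \<omega>) (p t \<omega>) (P t \<omega>)) (z u t \<omega>)"
  let ?cp = "\<lambda>t \<omega>. - gradient (\<lambda>\<theta>. H t \<theta> (y u t \<omega>) (z u t \<omega>) (u t \<omega>) (k t \<omega>) (p t \<omega>) (P t \<omega>)) (x u t \<omega>)"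
  have dk: "ito_differential M F W T k ?ck ?Qk" and dp: "ito_differential M F W T p ?cp P"
    using adjoint unfolding adjoint_equation_def by blast+
  \<comment> \<open>These hold at every point, not only almost surely, since \<open>u\<close> takes
    values in \<open>U\<close> everywhere.\<close>
  have ck: "?ck t \<omega> = 0" and Qk: "?Qk t \<omega> = 0" and cp: "?cp t \<omega> = 0"
    if "t \<in> {0..T}" "\<omega> \<in> space M" for t \<omega>
    using hamiltonian_gradient_zero[OF cvx bd, OF that(1) control_U[OF u that] that(1) control_U[OF u that]]
    unfolding H_def by simp_all
  \<comment> \<open>Neither drift nor integrand remains, so the initial condition of
    \<open>k\<close> is known at time \<open>T\<close>, where
    \<open>expectation_martingale_product\<close> evaluates it.\<close>
  have kT: "AE \<omega> in M. k T \<omega> = k 0 \<omega>"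
  proof -
    obtain I where I: "has_ito_integral M F W T ?Qk I"
      and "\<And>t. t \<in> {0..T} \<Longrightarrow> AE \<omega> in M. k t \<omega> = k 0 \<omega> + I t \<omega>"
      by (rule driftless_ito_differential[OF dk ck]) (assumption+, rule that)
    then have "AE \<omega> in M. k T \<omega> = k 0 \<omega> + I T \<omega>" using T(3) by blast
    moreover have "AE \<omega> in M. I T \<omega> = 0"
      by (rule ito_integral_zero_integrand[OF I T(3) Qk])
    ultimately show ?thesis by eventually_elim simp
  qed
  define B where "B w t \<omega> = b t (x w t \<omega>) (w t \<omega>)" for w t \<omega>
  define S where "S w t \<omega> = \<sigma> t (x w t \<omega>) (w t \<omega>)" for w t \<omega>
  define \<Phi> where "\<Phi> w t \<omega> = f t (x w t \<omega>) (y w t \<omega>) (z w t \<omega>) (w t \<omega>)" for w t \<omega>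
  define L where "L w t \<omega> = l t (x w t \<omega>) (y w t \<omega>) (z w t \<omega>) (w t \<omega>)" for w t \<omega>
  have S2_x: "S2_process M F T (x w)" and S2_y: "S2_process M F T (y w)" and M2_z: "M2_process M F T (z w)"
    and dx: "ito_differential M F W T (x w) (B w) (S w)"
    and x0w: "AE \<omega> in M. x w 0 \<omega> = x0 \<omega>"
    and dy: "ito_differential M F W T (y w) (\<lambda>t \<omega>. - \<Phi> w t \<omega>) (z w)"
    and yT: "AE \<omega> in M. y w T \<omega> = \<xi> \<omega>" if "w \<in> ?U" for w
    using state[OF that] unfolding state_equation_def B_def[abs_def] S_def[abs_def] \<Phi>_def[abs_def] by blast+
  have B_bd: "norm (B w t \<omega>) \<le> C" and \<Phi>_bd: "norm (- \<Phi> w t \<omega>) \<le> C" and L_bd: "\<bar>L w t \<omega>\<bar> \<le> C"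
    if "w \<in> ?U" "t \<in> {0..T}" "\<omega> \<in> space M" for w t \<omega>
    using bd[OF that(2) control_U[OF that]] by (simp_all add: B_def \<Phi>_def L_def)
  have L_meas: "case_prod (L w) \<in> borel_measurable ?TM" if w: "w \<in> ?U" for w
  proof -
    have "case_prod (x w) \<in> borel_measurable ?TM" "case_prod (y w) \<in> borel_measurable ?TM"
      "case_prod (z w) \<in> borel_measurable ?TM" "case_prod w \<in> borel_measurable ?TM"
      using S2_x[OF w] S2_y[OF w] M2_z[OF w] w unfolding S2_process_def M2_process_def strict_controls_def
      by (auto intro: measurable_adapted_process)
    then have "(\<lambda>s. (fst s, case_prod (x w) s, case_prod (y w) s, case_prod (z w) s, case_prod w s))
        \<in> borel_measurable ?TM"
      by (intro borel_measurable_Pair measurable_time_product_time)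
    \<comment> \<open>Measurability of \<open>l\<close> is assumed on the set with time in
      \<open>{0..T}\<close> and control in \<open>U\<close>, so the range of the tuple is confined
      to it first.\<close>
    then have "(\<lambda>s. (fst s, case_prod (x w) s, case_prod (y w) s, case_prod (z w) s, case_prod w s))
        \<in> measurable ?TM (restrict_space borel ({0..T} \<times> UNIV \<times> UNIV \<times> UNIV \<times> U))"
      by (intro measurable_restrict_space2) (auto simp: space_pair_measure control_U[OF w])
    from measurable_compose[OF this l_meas] show ?thesis
      by (simp add: L_def[abs_def] split_def)
  qed
  note L_int = bounded_time_integral[OF L_meas L_bd]
  \<comment> \<open>\<open>p\<close> and \<open>k\<close> belong to \<open>u\<close> throughout,
    while \<open>w\<close> ranges over all controls.\<close>
  define Ex where "Ex w = expectation (\<lambda>\<omega>. p T \<omega> \<bullet> (x w T \<omega> - x w 0 \<omega>))" for w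
  define Ey where "Ey w = expectation (\<lambda>\<omega>. k T \<omega> \<bullet> (y w T \<omega> - y w 0 \<omega>))" for w
  have Ex: "Ex w = (\<integral>s. case_prod p s \<bullet> case_prod (B w) s \<partial>?TM) +
      (\<integral>s. case_prod P s \<bullet> case_prod (S w) s \<partial>?TM)" if w: "w \<in> ?U" for w
    unfolding Ex_def
    by (rule expectation_martingale_product[OF T(1) S2_p dp cp S2_x[OF w] dx[OF w] B_bd[OF w]])
  \<comment> \<open>The integrand \<open>?Qk\<close> of \<open>k\<close> vanishes, so no isometry
    term is left; the minus sign is that of the drift of \<open>y\<close>.\<close>
  have Ey: "Ey w = - (\<integral>s. case_prod k s \<bullet> case_prod (\<Phi> w) s \<partial>?TM)" if w: "w \<in> ?U" for w
  proof -
    have "(\<integral>s. case_prod ?Qk s \<bullet> case_prod (z w) s \<partial>?TM) = (\<integral>s. 0 \<partial>?TM)"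
      by (intro Bochner_Integration.integral_cong refl) (auto simp: space_pair_measure Qk)
    then show ?thesis
      unfolding Ey_def
      using expectation_martingale_product[OF T(1) S2_k dk ck S2_y[OF w] dy[OF w] \<Phi>_bd[OF w]]
      by (simp add: split_def)
  qed
  have J: "J w = expectation (\<lambda>\<omega>. g (x w T \<omega>)) + expectation (\<lambda>\<omega>. h (y w 0 \<omega>)) +
      (\<integral>s. case_prod (L w) s \<partial>?TM)"
    and int_g: "integrable M (\<lambda>\<omega>. g (x w T \<omega>))" and int_h: "integrable M (\<lambda>\<omega>. h (y w 0 \<omega>))"
    if w: "w \<in> ?U" for w
  proof -
    show int: "integrable M (\<lambda>\<omega>. g (x w T \<omega>))" "integrable M (\<lambda>\<omega>. h (y w 0 \<omega>))"
      using integrable_linear_growth[OF g_meas g_growth S2_process_sq_integrable[OF S2_x[OF w] T(3)]]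
        integrable_linear_growth[OF h_meas h_growth S2_process_sq_integrable[OF S2_y[OF w] T(2)]] .
    have "J w = expectation (\<lambda>\<omega>. g (x w T \<omega>) + h (y w 0 \<omega>) + (LINT t:{0..T}|lborel. L w t \<omega>))"
      unfolding J_def cost_def L_def ..
    also have "\<dots> = expectation (\<lambda>\<omega>. g (x w T \<omega>)) + expectation (\<lambda>\<omega>. h (y w 0 \<omega>)) +
        expectation (\<lambda>\<omega>. LINT t:{0..T}|lborel. L w t \<omega>)"
      using int L_int(2)[OF w w] by simp
    also note L_int(3)[OF w w]
    finally show "J w = expectation (\<lambda>\<omega>. g (x w T \<omega>)) + expectation (\<lambda>\<omega>. h (y w 0 \<omega>)) +
      (\<integral>s. case_prod (L w) s \<partial>?TM)" .
  qed
  have le: "J u \<le> J v" if v: "v \<in> ?U" for v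
  proof -
    have int_x: "integrable M (\<lambda>\<omega>. p T \<omega> \<bullet> (x w T \<omega> - x w 0 \<omega>))"
      and int_y: "integrable M (\<lambda>\<omega>. k T \<omega> \<bullet> (y w T \<omega> - y w 0 \<omega>))" if "w \<in> ?U" for w
      by (intro sq_integrable_inner sq_integrable_diff S2_process_sq_integrable[OF S2_p T(3)]
        S2_process_sq_integrable[OF S2_k T(3)]
        S2_process_sq_integrable[OF S2_x[OF that]] S2_process_sq_integrable[OF S2_y[OF that]] T)+
    \<comment> \<open>Tangent inequality for \<open>g\<close> at \<open>x u T\<close>; the common
      initial value makes the difference of increments equal to
      \<open>x v T - x u T\<close>.\<close>
    have "expectation (\<lambda>\<omega>. p T \<omega> \<bullet> (x v T \<omega> - x v 0 \<omega>) - p T \<omega> \<bullet> (x u T \<omega> - x u 0 \<omega>)) \<le>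
        expectation (\<lambda>\<omega>. g (x v T \<omega>) - g (x u T \<omega>))"
    proof (rule integral_mono_AE)
      show "AE \<omega> in M. p T \<omega> \<bullet> (x v T \<omega> - x v 0 \<omega>) - p T \<omega> \<bullet> (x u T \<omega> - x u 0 \<omega>) \<le>
          g (x v T \<omega>) - g (x u T \<omega>)"
        using pT x0w[OF v] x0w[OF u]
      proof eventually_elim
        case (elim \<omega>)
        then show ?case
          using convex_above_gradient[OF \<open>convex_on UNIV g\<close> Dg, of "x u T \<omega>" "x v T \<omega>"]
          by (simp add: inner_diff_right)
      qed
    qed (use int_x[OF v] int_x[OF u] int_g[OF v] int_g[OF u] in auto)
    then have 1: "Ex v - Ex u \<le> expectation (\<lambda>\<omega>. g (x v T \<omega>)) - expectation (\<lambda>\<omega>. g (x u T \<omega>))"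
      using int_x[OF v] int_x[OF u] int_g[OF v] int_g[OF u] by (simp add: Ex_def)
    \<comment> \<open>The order of \<open>u\<close> and \<open>v\<close> is reversed: the terminal
      values agree, so the difference of increments is \<open>y v 0 - y u 0\<close>. Together with
      \<open>kT\<close> this is the tangent inequality for \<open>h\<close> at
      \<open>y u 0\<close>.\<close>
    have "expectation (\<lambda>\<omega>. k T \<omega> \<bullet> (y u T \<omega> - y u 0 \<omega>) - k T \<omega> \<bullet> (y v T \<omega> - y v 0 \<omega>)) \<le>
        expectation (\<lambda>\<omega>. h (y v 0 \<omega>) - h (y u 0 \<omega>))"
    proof (rule integral_mono_AE)
      show "AE \<omega> in M. k T \<omega> \<bullet> (y u T \<omega> - y u 0 \<omega>) - k T \<omega> \<bullet> (y v T \<omega> - y v 0 \<omega>) \<le>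
          h (y v 0 \<omega>) - h (y u 0 \<omega>)"
        using kT k0 yT[OF v] yT[OF u]
      proof eventually_elim
        case (elim \<omega>)
        then show ?case
          using convex_above_gradient[OF \<open>convex_on UNIV h\<close> Dh, of "y u 0 \<omega>" "y v 0 \<omega>"]
          by (simp add: inner_diff_right)
      qed
    qed (use int_y[OF v] int_y[OF u] int_h[OF v] int_h[OF u] in auto)
    then have 2: "Ey u - Ey v \<le> expectation (\<lambda>\<omega>. h (y v 0 \<omega>)) - expectation (\<lambda>\<omega>. h (y u 0 \<omega>))"
      using int_y[OF v] int_y[OF u] int_h[OF v] int_h[OF u] by (simp add: Ey_def)
    \<comment> \<open>The Hamiltonian along the trajectory of \<open>w\<close>, with the adjoint
      processes of \<open>u\<close>.\<close>
    define G where "G w s = case_prod (L w) s + case_prod p s \<bullet> case_prod (B w) s +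
        case_prod P s \<bullet> case_prod (S w) s + case_prod k s \<bullet> case_prod (\<Phi> w) s" for w s
    have TM_bounded: "sq_integrable ?TM (case_prod a)"
      if "case_prod a \<in> borel_measurable ?TM" "\<And>t \<omega>. t \<in> {0..T} \<Longrightarrow> \<omega> \<in> space M \<Longrightarrow> norm (a t \<omega>) \<le> C"
      for a :: "real \<Rightarrow> 'w \<Rightarrow> 'b::euclidean_space"
      using that by (intro TM.sq_integrable_bounded[where C = C]) (auto simp: space_pair_measure)
    \<comment> \<open>The integral collects the running cost and both pairings; \<open>Ey\<close>
      enters negatively because the drift of \<open>y\<close> is minus \<open>f\<close>.\<close>
    have G: "integrable ?TM (G w) \<and> integral\<^sup>L ?TM (G w) = (\<integral>s. case_prod (L w) s \<partial>?TM) + Ex w - Ey w"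
      if w: "w \<in> ?U" for w
    proof -
      have sq: "sq_integrable ?TM (case_prod p)" "sq_integrable ?TM (case_prod k)"
        "sq_integrable ?TM (case_prod P)"
        using S2_p S2_k adjoint unfolding adjoint_equation_def
        by (auto intro: M2_process_sq_integrable S2_process_imp_M2_process)
      have "adapted_process M F T (B w)" and "M2_process M F T (S w)"
        using dx[OF w] unfolding ito_differential_def has_ito_integral_def by blast+
      then have sqB: "sq_integrable ?TM (case_prod (B w))" and sqS: "sq_integrable ?TM (case_prod (S w))"
        using measurable_adapted_process[of T "B w"] B_bd[OF w]
        by (blast intro: M2_process_sq_integrable TM_bounded)+
      \<comment> \<open>Measurability is known for the drift \<open>- \<Phi> w\<close>, so the sign
        is removed at the end.\<close>
      have "adapted_process M F T (\<lambda>t \<omega>. - \<Phi> w t \<omega>)"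
        using dy[OF w] unfolding ito_differential_def by blast
      then have "(\<lambda>(t, \<omega>). - \<Phi> w t \<omega>) \<in> borel_measurable ?TM"
        by (rule measurable_adapted_process)
      then have "sq_integrable ?TM (\<lambda>(t, \<omega>). - \<Phi> w t \<omega>)"
        using \<Phi>_bd[OF w] by (rule TM_bounded)
      from sq_integrable_minus[OF this] have sq\<Phi>: "sq_integrable ?TM (case_prod (\<Phi> w))"
        by (simp add: split_def)
      note ints = L_int(1)[OF w w] sq_integrable_inner[OF sq(1) sqB] sq_integrable_inner[OF sq(3) sqS]
        sq_integrable_inner[OF sq(2) sq\<Phi>]
      show ?thesis
        unfolding G_def[abs_def] Ex[OF w] Ey[OF w] using ints by simp
    qed
    \<comment> \<open>No coefficient depends on the state, so those at the state of \<open>w\<close>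
      equal those at the state of \<open>u\<close>. This puts \<open>G w\<close> into the form of
      the minimum condition.\<close>
    have G_H: "G w (t, \<omega>) = H t (x u t \<omega>) (y u t \<omega>) (z u t \<omega>) (w t \<omega>) (k t \<omega>) (p t \<omega>) (P t \<omega>)"
      if "w \<in> ?U" "t \<in> {0..T}" "\<omega> \<in> space M" for w t \<omega>
    proof -
      note c = hamiltonian_convex_imp_coefficients_const[OF cvx bd,
          OF that(2) control_U[OF that] that(2) control_U[OF that]]
      show ?thesis
        unfolding G_def H_def hamiltonian_def B_def S_def \<Phi>_def L_def
        using c(1)[of "x w t \<omega>" "y w t \<omega>" "z w t \<omega>" "x u t \<omega>" "y u t \<omega>" "z u t \<omega>"]
          c(2)[of "x w t \<omega>" "x u t \<omega>"] c(3)[of "x w t \<omega>" "x u t \<omega>"]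
          c(4)[of "x w t \<omega>" "y w t \<omega>" "z w t \<omega>" "x u t \<omega>" "y u t \<omega>" "z u t \<omega>"] by simp
    qed
    have "integral\<^sup>L ?TM (G u) \<le> integral\<^sup>L ?TM (G v)"
    proof (rule integral_time_product_mono)
      show "AE t in lborel. t \<in> {0..T} \<longrightarrow> (AE \<omega> in M. G u (t, \<omega>) \<le> G v (t, \<omega>))"
        using \<open>\<And>v. v \<in> strict_controls M F T U \<Longrightarrow>
           AE t in lborel. t \<in> {0..T} \<longrightarrow>
             (AE \<omega> in M. H t (x u t \<omega>) (y u t \<omega>) (z u t \<omega>) (u t \<omega>) (k t \<omega>) (p t \<omega>) (P t \<omega>)
                       \<le> H t (x u t \<omega>) (y u t \<omega>) (z u t \<omega>) (v t \<omega>) (k t \<omega>) (p t \<omega>) (P t \<omega>))\<close>[OF v]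
      proof eventually_elim
        case (elim t)
        show ?case
        proof
          assume t: "t \<in> {0..T}"
          with elim have "AE \<omega> in M. H t (x u t \<omega>) (y u t \<omega>) (z u t \<omega>) (u t \<omega>) (k t \<omega>) (p t \<omega>) (P t \<omega>)
                       \<le> H t (x u t \<omega>) (y u t \<omega>) (z u t \<omega>) (v t \<omega>) (k t \<omega>) (p t \<omega>) (P t \<omega>)"
            by blast
          with AE_space show "AE \<omega> in M. G u (t, \<omega>) \<le> G v (t, \<omega>)"
            by eventually_elim (simp add: G_H[OF u t] G_H[OF v t])
        qed
      qed
    qed (use G[OF u] G[OF v] in auto)
    \<comment> \<open>By the two tangent estimates \<open>1\<close> and \<open>2\<close>,
      \<open>J v - J u\<close> is at least the integral of \<open>G v\<close> minus that of
      \<open>G u\<close>.\<close>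
    then show ?thesis
      using G[OF u] G[OF v] J[OF u] J[OF v] 1 2 by linarith
  qed
  \<comment> \<open>\<open>u\<close> is itself in the index set, so the lower bound
    \<open>le\<close> is attained.\<close>
  show ?thesis
    using le u by (intro antisym INF_greatest INF_lower) auto
qed

end
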